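(* (i) Suppose the Markov kernel $P$ is reversible with respect to its stationary distribution $\pi$. Then for every integer $k\ge 1$, $$\gamma^*\ \ge\ 1-(1-\kappa_k)^{1/k}\ \ge\ \frac{\kappa_k}{k}.$$ (ii) Without assuming reversibility, for every integer $k\ge 1$, $$\gamma_{\mathrm{ps}}\ \ge\ \frac{1-(1-\kappa_k(P^* ))(1-\kappa_k)}{k},$$ where $\kappa_k(P^* )$ denotes the $k$-step coarse Ricci curvature of the time reversal $P^*$ of $P$.
   Context: $(\Omega,d)$ is a Polish metric space and $P(x,\mathrm{d}y)$ is a Markov kernel on $\Omega$, measurable in $x$, with stationary distribution $\pi$; $P_x=P(x,\cdot)$, and $W_1(\delta_x,P_x)<\infty$ for every $x$. $P^k_x$ is the $k$-step kernel, $P^0_x=\delta_x$. $W_1(\mu_1,\mu_2)=\inf\mathbb{E}(d(X,Y))$ over all couplings $(X,Y)$ of $\mu_1,\mu_2$. Multi-step coarse Ricci curvature: $\kappa_k(x,y)=1-W_1(P^k_x,P^k_y)/d(x,y)$ for $x\ne y$, $\kappa_k(x,x)=1$, and $\kappa_k=\inf_{x,y\in\Omega}\kappa_k(x,y)$ (if a curvature equals $-\infty$ the corresponding bound is read as trivially true). $L_2(\pi)$ is the Hilbert space of complex-valued $\pi$-square-integrable functions with $\langle f,g\rangle_\pi=\int f\bar g\,\mathrm{d}\pi$; $\mathbf{P}$ acts on it by $(\mathbf{P}f)(x)=\mathbb{E}_{P_x}(f)$. The time reversal is the Markov kernel $P^*(x,\mathrm{d}y)=\frac{P(y,\mathrm{d}x)}{\pi(\mathrm{d}x)}\pi(\mathrm{d}y)$,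 whose operator $\mathbf{P}^*$ is the adjoint of $\mathbf{P}$ on $L_2(\pi)$. The spectrum is $S_2=\{\lambda\in\mathbb{C}\setminus\{0\}: (\lambda \mathbf{I}-\mathbf{P})^{-1}\text{ does not exist as a bounded linear operator on }L_2(\pi)\}$. Absolute spectral gap: $\gamma^*=1-\sup\{|\lambda|:\lambda\in S_2,\lambda\ne1\}$ if the eigenvalue $1$ has multiplicity $1$, and $\gamma^*=0$ otherwise. Spectral gap of a reversible (self-adjoint) operator: $\gamma=1-\sup\{\lambda:\lambda\in S_2,\lambda\neq 1\}$ if the eigenvalue $1$ has multiplicity 1, and $\gamma=0$ otherwise. (Supremum of the empty set is $0$.) Pseudo spectral gap: $\gamma_{\mathrm{ps}}=\max_{k\ge1}\{\gamma((\mathbf{P}^* )^k\mathbf{P}^k)/k\}$, where $\gamma((\mathbf{P}^* )^k\mathbf{P}^k)$ is the spectral gap of the self-adjoint operator $(\mathbf{P}^* )^k\mathbf{P}^k$ (the maximum is read as a supremum). *)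

theory Defs
  imports "HOL-Probability.Probability"
begin

section \<open>Markov kernels on a Polish metric space\<close>

definition markov_kernel :: "('a::polish_space \<Rightarrow> 'a measure) \<Rightarrow> bool" where
  "markov_kernel P \<longleftrightarrow> P \<in> borel \<rightarrow>\<^sub>M prob_algebra borel"

definition stationary :: "'a::polish_space measure \<Rightarrow> ('a \<Rightarrow> 'a measure) \<Rightarrow> bool" where
  "stationary \<pi> P \<longleftrightarrow> \<pi> \<in> space (prob_algebra borel) \<and> \<pi> \<bind> P = \<pi>"

primrec kernel_pow :: "('a::polish_space \<Rightarrow> 'a measure) \<Rightarrow> nat \<Rightarrow> 'a \<Rightarrow> 'a measure" where
  "kernel_pow P 0 x = return borel x"
| "kernel_pow P (Suc k) x = kernel_pow P k x \<bind> P"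

text \<open>
  The relation \<open>\<pi>(dx) Q(x,dy) = \<pi>(dy) P(y,dx)\<close> between measures on the product space, tested on
  measurable rectangles. It determines \<open>Q(x,_)\<close> only for \<open>\<pi>\<close>-almost every \<open>x\<close>, so a time reversal
  is any Markov kernel satisfying it.
\<close>

definition time_reversal ::
    "'a::polish_space measure \<Rightarrow> ('a \<Rightarrow> 'a measure) \<Rightarrow> ('a \<Rightarrow> 'a measure) \<Rightarrow> bool" where
  "time_reversal \<pi> P Q \<longleftrightarrow> markov_kernel Q \<and>
     (\<forall>A\<in>sets borel. \<forall>B\<in>sets borel.
        (\<integral>\<^sup>+x\<in>A. emeasure (Q x) B \<partial>\<pi>) = (\<integral>\<^sup>+y\<in>B. emeasure (P y) A \<partial>\<pi>))"

definition reversible :: "'a::polish_space measure \<Rightarrow> ('a \<Rightarrow> 'a measure) \<Rightarrow> bool" where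
  "reversible \<pi> P \<longleftrightarrow> time_reversal \<pi> P P"

section \<open>Wasserstein distance and coarse Ricci curvature\<close>

definition couplings :: "'a::polish_space measure \<Rightarrow> 'a measure \<Rightarrow> ('a \<times> 'a) measure set" where
  "couplings \<mu> \<nu> = {m \<in> space (prob_algebra (borel \<Otimes>\<^sub>M borel)).
     distr m borel fst = \<mu> \<and> distr m borel snd = \<nu>}"

definition W1 :: "'a::polish_space measure \<Rightarrow> 'a measure \<Rightarrow> ennreal" where
  "W1 \<mu> \<nu> = (INF m\<in>couplings \<mu> \<nu>. \<integral>\<^sup>+z. ennreal (dist (fst z) (snd z)) \<partial>m)"

text \<open>
  For \<open>k \<ge> 2\<close> the distance between the \<open>k\<close>-step kernels may be infinite, and the infimum over all
  pairs may be \<open>-\<infinity>\<close> in any case; hence the curvatures are extended reals. They never exceed 1.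
\<close>

definition ricci_at :: "('a::polish_space \<Rightarrow> 'a measure) \<Rightarrow> nat \<Rightarrow> 'a \<Rightarrow> 'a \<Rightarrow> ereal" where
  "ricci_at P k x y = (if x = y then 1
     else 1 - enn2ereal (W1 (kernel_pow P k x) (kernel_pow P k y) / ennreal (dist x y)))"

definition ricci :: "('a::polish_space \<Rightarrow> 'a measure) \<Rightarrow> nat \<Rightarrow> ereal" where
  "ricci P k = (INF x. INF y. ricci_at P k x y)"

section \<open>Operators on the complex \<open>L\<^sub>2\<close> space and their spectrum\<close>

text \<open>
  Elements of the Hilbert space are represented by square-integrable functions, equality in the
  space being almost-everywhere equality, and operators by maps on representatives. An operator that
  is linear and bounded in the sense below maps a.e. equal functions to a.e. equal functions, so it
  is a bounded linear operator on equivalence classes; conversely, every bounded linear operator on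
  classes arises in this way by choosing representatives.
\<close>

definition L2 :: "'a measure \<Rightarrow> ('a \<Rightarrow> complex) set" where
  "L2 M = {f \<in> borel_measurable M. integrable M (\<lambda>x. (cmod (f x))\<^sup>2)}"

definition L2_norm :: "'a measure \<Rightarrow> ('a \<Rightarrow> complex) \<Rightarrow> real" where
  "L2_norm M f = sqrt (\<integral>x. (cmod (f x))\<^sup>2 \<partial>M)"

definition bounded_op :: "'a measure \<Rightarrow> (('a \<Rightarrow> complex) \<Rightarrow> 'a \<Rightarrow> complex) \<Rightarrow> bool" where
  "bounded_op M T \<longleftrightarrow>
     (\<forall>f\<in>L2 M. T f \<in> L2 M) \<and>
     (\<forall>f\<in>L2 M. \<forall>g\<in>L2 M. AE x in M. T (\<lambda>x. f x + g x) x = T f x + T g x) \<and>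
     (\<forall>c. \<forall>f\<in>L2 M. AE x in M. T (\<lambda>x. c * f x) x = c * T f x) \<and>
     (\<exists>C. \<forall>f\<in>L2 M. L2_norm M (T f) \<le> C * L2_norm M f)"

definition is_resolvent ::
    "'a measure \<Rightarrow> (('a \<Rightarrow> complex) \<Rightarrow> 'a \<Rightarrow> complex) \<Rightarrow> complex \<Rightarrow>
     (('a \<Rightarrow> complex) \<Rightarrow> 'a \<Rightarrow> complex) \<Rightarrow> bool" where
  "is_resolvent M T z R \<longleftrightarrow> bounded_op M R \<and>
     (\<forall>f\<in>L2 M. (AE x in M. R (\<lambda>x. z * f x - T f x) x = f x) \<and>
                (AE x in M. z * R f x - T (R f) x = f x))"

definition spectrum_L2 :: "'a measure \<Rightarrow> (('a \<Rightarrow> complex) \<Rightarrow> 'a \<Rightarrow> complex) \<Rightarrow> complex set" where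
  "spectrum_L2 M T = {z. z \<noteq> 0 \<and> \<not> (\<exists>R. is_resolvent M T z R)}"

text \<open>The eigenvalue 1 has multiplicity 1: its eigenspace is spanned by one nonzero vector.\<close>

definition eigenvalue_1_simple :: "'a measure \<Rightarrow> (('a \<Rightarrow> complex) \<Rightarrow> 'a \<Rightarrow> complex) \<Rightarrow> bool" where
  "eigenvalue_1_simple M T \<longleftrightarrow>
     (\<exists>e\<in>L2 M. (AE x in M. T e x = e x) \<and> \<not> (AE x in M. e x = 0) \<and>
        (\<forall>f\<in>L2 M. (AE x in M. T f x = f x) \<longrightarrow> (\<exists>c. AE x in M. f x = c * e x)))"

text \<open>On \<open>real\<close>, \<open>Sup {}\<close> is not 0 by definition.\<close>

definition Sup0 :: "real set \<Rightarrow> real" where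
  "Sup0 A = (if A = {} then 0 else Sup A)"

definition abs_spectral_gap :: "'a measure \<Rightarrow> (('a \<Rightarrow> complex) \<Rightarrow> 'a \<Rightarrow> complex) \<Rightarrow> real" where
  "abs_spectral_gap M T = (if eigenvalue_1_simple M T
     then 1 - Sup0 {cmod z |z. z \<in> spectrum_L2 M T \<and> z \<noteq> 1} else 0)"

text \<open>For self-adjoint operators, whose spectrum is real.\<close>

definition spectral_gap :: "'a measure \<Rightarrow> (('a \<Rightarrow> complex) \<Rightarrow> 'a \<Rightarrow> complex) \<Rightarrow> real" where
  "spectral_gap M T = (if eigenvalue_1_simple M T
     then 1 - Sup0 {r. complex_of_real r \<in> spectrum_L2 M T \<and> r \<noteq> 1} else 0)"

definition kernel_op :: "('a \<Rightarrow> 'a measure) \<Rightarrow> ('a \<Rightarrow> complex) \<Rightarrow> 'a \<Rightarrow> complex" where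
  "kernel_op P f x = (\<integral>y. f y \<partial>P x)"

text \<open>
  \<open>Q\<close> is a time reversal of \<open>P\<close>, so that \<open>kernel_op Q\<close> is the adjoint of \<open>kernel_op P\<close>. The operators
  under the supremum are positive semidefinite, so their gaps are at most 1 and the set is bounded.
\<close>

definition pseudo_spectral_gap ::
    "'a measure \<Rightarrow> ('a \<Rightarrow> 'a measure) \<Rightarrow> ('a \<Rightarrow> 'a measure) \<Rightarrow> real" where
  "pseudo_spectral_gap M P Q =
     (SUP k\<in>{1::nat..}. spectral_gap M ((kernel_op Q ^^ k) \<circ> (kernel_op P ^^ k)) / real k)"

end

theory Submission
  imports Defs
begin

text \<open>
  Let \<open>f\<close> be Lipschitz with bounded support and mean zero. If \<open>T\<close> is self-adjoint and \<open>T\<^sup>k\<close>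
  contracts Lipschitz constants by the factor \<open>c\<^sup>k\<close>, then \<open>\<parallel>T\<^sup>n\<^sup>k f\<parallel>\<^sup>2 = \<langle>f, T\<^sup>2\<^sup>n\<^sup>k f\<rangle>\<close> is at
  most \<open>C(f) c\<^sup>2\<^sup>n\<^sup>k\<close>: since \<open>f\<close> has mean zero, only the oscillation of \<open>T\<^sup>2\<^sup>n\<^sup>k f\<close> on the support
  of \<open>f\<close> enters. No moment of \<open>\<pi>\<close> is involved, and the constant \<open>C(f)\<close> is harmless: the sequence
  \<open>\<parallel>T\<^sup>m f\<parallel>\<close> is log-convex, so its decay rate already bounds its first ratio,
  \<open>\<parallel>T f\<parallel> \<le> c \<parallel>f\<parallel>\<close>. Such \<open>f\<close> are dense among the mean-zero functions of \<open>L\<^sub>2\<close>, so \<open>T\<close> has norm at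
  most \<open>c\<close> there, which bounds its spectrum apart from 1 and makes 1 simple when \<open>c < 1\<close>.
  Kantorovich's easy inequality turns the Ricci curvature into Lipschitz contraction; part (i) is
  \<open>T = P\<close> with \<open>c\<^sup>k = 1 - \<kappa>\<^sub>k\<close>, part (ii) is the self-adjoint operator \<open>T = (P\<^sup>*)\<^sup>k P\<^sup>k\<close>, which
  contracts Lipschitz constants by \<open>(1 - \<kappa>\<^sub>k(P\<^sup>*)) (1 - \<kappa>\<^sub>k)\<close> in a single step.
\<close>

section \<open>The space \<open>L\<^sub>2\<close>\<close>

lemma borel_measurable_cnj [measurable (raw)]:
  "f \<in> borel_measurable M \<Longrightarrow> (\<lambda>x. cnj (f x)) \<in> borel_measurable M"
  by (rule borel_measurable_continuous_on) (auto intro: continuous_intros)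

lemma L2_measurable [measurable_dest]: "f \<in> L2 M \<Longrightarrow> f \<in> borel_measurable M"
  by (simp add: L2_def)

lemma L2_integrable_power2: "f \<in> L2 M \<Longrightarrow> integrable M (\<lambda>x. (cmod (f x))\<^sup>2)"
  by (simp add: L2_def)

lemma L2_iff_nn_integral:
  "f \<in> L2 M \<longleftrightarrow> f \<in> borel_measurable M \<and> (\<integral>\<^sup>+x. ennreal ((cmod (f x))\<^sup>2) \<partial>M) < \<infinity>"
  by (auto simp: L2_def integrable_iff_bounded)

lemma L2_norm_nonneg [simp]: "0 \<le> L2_norm M f"
  by (simp add: L2_norm_def)

lemma L2_norm_power2: "(L2_norm M f)\<^sup>2 = (\<integral>x. (cmod (f x))\<^sup>2 \<partial>M)"
  by (simp add: L2_norm_def)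

lemma nn_integral_L2_norm:
  "f \<in> L2 M \<Longrightarrow> (\<integral>\<^sup>+x. ennreal ((cmod (f x))\<^sup>2) \<partial>M) = ennreal ((L2_norm M f)\<^sup>2)"
  by (simp add: L2_norm_power2 L2_def nn_integral_eq_integral)

lemma L2_norm_cong_AE:
  assumes "f \<in> borel_measurable M" "g \<in> borel_measurable M" "AE x in M. f x = g x"
  shows "L2_norm M f = L2_norm M g"
  unfolding L2_norm_def using assms by (intro arg_cong[where f = sqrt] integral_cong_AE) auto

lemma L2_bound:
  assumes "f \<in> L2 M" "g \<in> borel_measurable M" "AE x in M. cmod (g x) \<le> cmod (f x)"
  shows "g \<in> L2 M"
proof -
  have "(\<integral>\<^sup>+x. ennreal ((cmod (g x))\<^sup>2) \<partial>M) \<le> (\<integral>\<^sup>+x. ennreal ((cmod (f x))\<^sup>2) \<partial>M)"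
    by (rule nn_integral_mono_AE) (use assms(3) in \<open>auto intro!: ennreal_leI power_mono\<close>)
  then show ?thesis
    using assms by (auto simp: L2_iff_nn_integral)
qed

lemma L2_add:
  assumes [measurable]: "f \<in> L2 M" "g \<in> L2 M"
  shows "(\<lambda>x. f x + g x) \<in> L2 M"
proof -
  have int: "integrable M (\<lambda>x. 2 * (cmod (f x))\<^sup>2 + 2 * (cmod (g x))\<^sup>2)"
    by (intro Bochner_Integration.integrable_add integrable_mult_right L2_integrable_power2 assms)
  have "(cmod (f x + g x))\<^sup>2 \<le> 2 * (cmod (f x))\<^sup>2 + 2 * (cmod (g x))\<^sup>2" for x
  proof -
    have "(cmod (f x + g x))\<^sup>2 \<le> (cmod (f x) + cmod (g x))\<^sup>2"
      by (intro power_mono norm_triangle_ineq) auto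
    also have "\<dots> \<le> 2 * (cmod (f x))\<^sup>2 + 2 * (cmod (g x))\<^sup>2"
      using sum_squares_bound[of "cmod (f x)" "cmod (g x)"] by (simp add: power2_sum)
    finally show ?thesis .
  qed
  then have "integrable M (\<lambda>x. (cmod (f x + g x))\<^sup>2)"
    by (intro Bochner_Integration.integrable_bound[OF int]) auto
  then show ?thesis
    unfolding L2_def by auto
qed

lemma L2_scale: "f \<in> L2 M \<Longrightarrow> (\<lambda>x. c * f x) \<in> L2 M"
  by (auto simp: L2_def norm_mult power_mult_distrib)

lemma L2_norm_scale: "L2_norm M (\<lambda>x. c * f x) = cmod c * L2_norm M f"
  by (simp add: L2_norm_def norm_mult power_mult_distrib real_sqrt_mult)

lemma L2_diff: "f \<in> L2 M \<Longrightarrow> g \<in> L2 M \<Longrightarrow> (\<lambda>x. f x - g x) \<in> L2 M"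
  using L2_add[of f M "\<lambda>x. (-1) * g x"] L2_scale[of g M "-1"] by simp

lemma L2_sum: "(\<And>i. i \<in> I \<Longrightarrow> f i \<in> L2 M) \<Longrightarrow> (\<lambda>x. \<Sum>i\<in>I. f i x) \<in> L2 M"
proof (induction I rule: infinite_finite_induct)
  case (insert i I)
  then show ?case using L2_add[of "f i" M "\<lambda>x. \<Sum>i\<in>I. f i x"] by simp
qed (auto simp: L2_def)

lemma L2_norm_eq_0_iff:
  assumes "f \<in> L2 M"
  shows "L2_norm M f = 0 \<longleftrightarrow> (AE x in M. f x = 0)"
  using integral_nonneg_eq_0_iff_AE[OF L2_integrable_power2[OF assms]]
  by (simp add: L2_norm_def)

text \<open>Cauchy-Schwarz is stated for the nonnegative integral so that it also yields
  integrability of products of square-integrable functions, before any Bochner integral of such a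
  product is formed.\<close>

lemma L2_nn_integral_mult_le:
  assumes [measurable]: "f \<in> L2 M" "g \<in> L2 M"
  shows "(\<integral>\<^sup>+x. ennreal (cmod (f x) * cmod (g x)) \<partial>M) \<le> ennreal (L2_norm M f * L2_norm M g)"
proof -
  have "(\<integral>\<^sup>+x. ennreal (cmod (f x)) * ennreal (cmod (g x)) \<partial>M)\<^sup>2
      \<le> (\<integral>\<^sup>+x. (ennreal (cmod (f x)))\<^sup>2 \<partial>M) * (\<integral>\<^sup>+x. (ennreal (cmod (g x)))\<^sup>2 \<partial>M)"
    by (rule Cauchy_Schwarz_nn_integral) measurable
  also have "\<dots> = ennreal ((L2_norm M f)\<^sup>2) * ennreal ((L2_norm M g)\<^sup>2)"
    by (simp add: ennreal_power nn_integral_L2_norm assms)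
  also have "\<dots> = (ennreal (L2_norm M f * L2_norm M g))\<^sup>2"
    by (simp add: ennreal_power ennreal_mult[symmetric] power_mult_distrib)
  finally have le: "(\<integral>\<^sup>+x. ennreal (cmod (f x)) * ennreal (cmod (g x)) \<partial>M)\<^sup>2
      \<le> (ennreal (L2_norm M f * L2_norm M g))\<^sup>2" .
  \<comment> \<open>Square roots are taken by cases: a finite \<open>a\<close> reduces to real
    numbers, and \<open>a = \<top>\<close> is excluded because its square is infinite.\<close>
  have "a \<le> ennreal b" if "a\<^sup>2 \<le> (ennreal b)\<^sup>2" "0 \<le> b" for a :: ennreal and b
  proof (cases a rule: ennreal_cases)
    case (real r)
    with that have "r\<^sup>2 \<le> b\<^sup>2"
      by (simp add: ennreal_power)
    then show ?thesis
      using real that power2_le_imp_le by (auto intro!: ennreal_leI)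
  next
    case top
    with that show ?thesis
      by (simp add: ennreal_power power_top_ennreal top_unique)
  qed
  from this[OF le] show ?thesis
    by (simp add: ennreal_mult)
qed

lemma L2_integrable_mult:
  assumes "f \<in> L2 M" "g \<in> L2 M"
  shows "integrable M (\<lambda>x. f x * cnj (g x))"
proof -
  note [measurable] = assms
  have "(\<integral>\<^sup>+x. ennreal (cmod (f x) * cmod (g x)) \<partial>M) < \<infinity>"
    using L2_nn_integral_mult_le[OF assms] by (rule le_less_trans) simp
  moreover have "(\<lambda>x. f x * cnj (g x)) \<in> borel_measurable M"
    by measurable
  ultimately show ?thesis
    by (auto simp: integrable_iff_bounded norm_mult)
qed

definition L2_inner :: "'a measure \<Rightarrow> ('a \<Rightarrow> complex) \<Rightarrow> ('a \<Rightarrow> complex) \<Rightarrow> complex" where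
  "L2_inner M f g = (\<integral>x. f x * cnj (g x) \<partial>M)"

lemma L2_Cauchy_Schwarz:
  assumes "f \<in> L2 M" "g \<in> L2 M"
  shows "cmod (L2_inner M f g) \<le> L2_norm M f * L2_norm M g"
proof -
  have "ennreal (cmod (L2_inner M f g)) \<le> (\<integral>\<^sup>+x. ennreal (cmod (f x * cnj (g x))) \<partial>M)"
    unfolding L2_inner_def using L2_integrable_mult[OF assms] by (rule integral_norm_bound_ennreal)
  also have "\<dots> \<le> ennreal (L2_norm M f * L2_norm M g)"
    using L2_nn_integral_mult_le[OF assms] by (simp add: norm_mult)
  finally show ?thesis by simp
qed

lemma L2_inner_self: "L2_inner M f f = of_real ((L2_norm M f)\<^sup>2)"
  unfolding L2_inner_def L2_norm_power2 complex_norm_square[symmetric]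
  by (rule integral_complex_of_real)

lemma cnj_L2_inner: "cnj (L2_inner M f g) = L2_inner M g f"
  unfolding L2_inner_def by (simp flip: Bochner_Integration.integral_cnj add: mult.commute)

lemma L2_norm_triangle:
  assumes [measurable]: "f \<in> L2 M" "g \<in> L2 M"
  shows "L2_norm M (\<lambda>x. f x + g x) \<le> L2_norm M f + L2_norm M g"
proof -
  have fg: "integrable M (\<lambda>x. cmod (f x) * cmod (g x))"
    using integrable_norm[OF L2_integrable_mult[OF assms]] by (simp add: norm_mult)
  have "ennreal (\<integral>x. cmod (f x) * cmod (g x) \<partial>M) \<le> ennreal (L2_norm M f * L2_norm M g)"
    using L2_nn_integral_mult_le[OF assms] fg by (simp add: nn_integral_eq_integral)
  then have le: "(\<integral>x. cmod (f x) * cmod (g x) \<partial>M) \<le> L2_norm M f * L2_norm M g"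
    by simp
  have "(\<integral>x. (cmod (f x + g x))\<^sup>2 \<partial>M)
      \<le> (\<integral>x. (cmod (f x))\<^sup>2 + (cmod (g x))\<^sup>2 + 2 * (cmod (f x) * cmod (g x)) \<partial>M)"
  proof (rule integral_mono)
    show "(cmod (f x + g x))\<^sup>2 \<le> (cmod (f x))\<^sup>2 + (cmod (g x))\<^sup>2 + 2 * (cmod (f x) * cmod (g x))" for x
      using power_mono[OF norm_triangle_ineq[of "f x" "g x"], of 2] by (simp add: power2_sum mult.assoc)
  qed (intro Bochner_Integration.integrable_add integrable_mult_right fg L2_integrable_power2
        L2_add assms)+
  also have "\<dots> = (L2_norm M f)\<^sup>2 + (L2_norm M g)\<^sup>2 + 2 * (\<integral>x. cmod (f x) * cmod (g x) \<partial>M)"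
    using fg by (simp add: L2_norm_power2 L2_integrable_power2 assms)
  also have "\<dots> \<le> (L2_norm M f + L2_norm M g)\<^sup>2"
    using le by (simp add: power2_sum)
  finally have "(L2_norm M (\<lambda>x. f x + g x))\<^sup>2 \<le> (L2_norm M f + L2_norm M g)\<^sup>2"
    by (simp add: L2_norm_power2)
  then show ?thesis
    by (rule power2_le_imp_le) simp
qed

lemma L2_norm_triangle_diff:
  assumes "f \<in> L2 M" "g \<in> L2 M"
  shows "L2_norm M (\<lambda>x. f x - g x) \<le> L2_norm M f + L2_norm M g"
  using L2_norm_triangle[OF assms(1) L2_scale[OF assms(2), of "-1"]]
    L2_norm_scale[of M "-1" g] by simp

lemma L2_norm_sum:
  assumes "finite I" "\<And>i. i \<in> I \<Longrightarrow> f i \<in> L2 M"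
  shows "L2_norm M (\<lambda>x. \<Sum>i\<in>I. f i x) \<le> (\<Sum>i\<in>I. L2_norm M (f i))"
  using assms
proof (induction I)
  case (insert i I)
  have "L2_norm M (\<lambda>x. f i x + (\<Sum>i\<in>I. f i x)) \<le> L2_norm M (f i) + L2_norm M (\<lambda>x. \<Sum>i\<in>I. f i x)"
    using insert.prems by (intro L2_norm_triangle L2_sum) auto
  then show ?case using insert by simp
qed (simp add: L2_norm_def)

section \<open>Norm bounds and completeness on a probability space\<close>

context prob_space begin

lemma L2_const [simp]: "(\<lambda>_. c) \<in> L2 M"
  by (simp add: L2_def)

lemma L2_norm_const [simp]: "L2_norm M (\<lambda>_. c) = cmod c"
  by (simp add: L2_norm_def prob_space)

lemma L2_integrable: "f \<in> L2 M \<Longrightarrow> integrable M f"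
  using L2_integrable_mult[OF _ L2_const[of 1], of f] by simp

lemma integral_le_L2_norm:
  assumes "f \<in> L2 M"
  shows "cmod (\<integral>x. f x \<partial>M) \<le> L2_norm M f"
  using L2_Cauchy_Schwarz[OF assms L2_const[of 1]] by (simp add: L2_inner_def prob_space)

lemma integral_norm_le_L2_norm:
  assumes [measurable]: "f \<in> L2 M"
  shows "(\<integral>x. cmod (f x) \<partial>M) \<le> L2_norm M f"
proof -
  have "(\<lambda>x. of_real (cmod (f x)) :: complex) \<in> L2 M"
    by (rule L2_bound[OF assms]) auto
  from integral_le_L2_norm[OF this] show ?thesis
    by (simp add: L2_norm_def)
qed

lemma L2_bounded:
  assumes "f \<in> borel_measurable M" "\<And>x. cmod (f x) \<le> B"
  shows "f \<in> L2 M" "L2_norm M f \<le> B"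
proof -
  have B: "0 \<le> B" using assms(2)[of undefined] norm_ge_zero order_trans by blast
  show f: "f \<in> L2 M"
    using L2_bound[OF L2_const[of "of_real B"] assms(1)] assms(2) B by auto
  have "(\<integral>x. (cmod (f x))\<^sup>2 \<partial>M) \<le> (\<integral>x. B\<^sup>2 \<partial>M)"
    using f assms(2) by (intro integral_mono) (auto intro: L2_integrable_power2 power_mono)
  then have "(L2_norm M f)\<^sup>2 \<le> B\<^sup>2"
    by (simp add: L2_norm_power2 prob_space)
  then show "L2_norm M f \<le> B"
    using B by (rule power2_le_imp_le)
qed

text \<open>Completeness in the form used by the Neumann series. \<open>L1\<close> norms are
  dominated by \<open>L2\<close> norms, so the series converges absolutely almost everywhere;
  Fatou's lemma then bounds the distance from the limit to a partial sum by the tail of the series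
  of norms.\<close>

lemma L2_complete:
  assumes f: "\<And>n. f n \<in> L2 M" and sm: "summable (\<lambda>n. L2_norm M (f n))"
  obtains g where "g \<in> L2 M" "(\<lambda>N. L2_norm M (\<lambda>x. g x - (\<Sum>n<N. f n x))) \<longlonglongrightarrow> 0"
proof -
  note [measurable] = f
  \<comment> \<open>Where the series diverges \<open>suminf\<close> has no meaningful value, but
    this happens only on a null set.\<close>
  define g where "g = (\<lambda>x. \<Sum>n. f n x)"
  define s where "s N x = (\<Sum>n<N. f n x)" for N x
  define tail where "tail N = (\<Sum>n. L2_norm M (f (n + N)))" for N
  have [measurable]: "g \<in> borel_measurable M" "\<And>N. s N \<in> borel_measurable M"
    unfolding g_def s_def by measurable
  have "(\<integral>\<^sup>+x. (\<Sum>n. ennreal (cmod (f n x))) \<partial>M) = (\<Sum>n. \<integral>\<^sup>+x. ennreal (cmod (f n x)) \<partial>M)"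
    by (rule nn_integral_suminf) measurable
  also have "\<dots> \<le> (\<Sum>n. ennreal (L2_norm M (f n)))"
    by (intro suminf_le)
       (auto simp: nn_integral_eq_integral integrable_norm L2_integrable f
             intro: ennreal_leI integral_norm_le_L2_norm)
  also have "\<dots> < \<infinity>"
    using sm by (simp add: suminf_ennreal_eq[OF _ summable_sums])
  finally have "AE x in M. (\<Sum>n. ennreal (cmod (f n x))) \<noteq> \<infinity>"
    by (intro nn_integral_PInf_AE) auto
  then have lim: "AE x in M. (\<lambda>N. s N x) \<longlonglongrightarrow> g x"
  proof eventually_elim
    case (elim x)
    then have "summable (\<lambda>n. cmod (f n x))"
      by (intro summable_suminf_not_top) auto
    then show ?case
      unfolding s_def g_def by (rule summable_LIMSEQ[OF summable_norm_cancel])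
  qed
  have s_L2: "s N \<in> L2 M" for N
    unfolding s_def using f by (intro L2_sum)
  have tail_nonneg: "0 \<le> tail N" for N
    unfolding tail_def using sm by (intro suminf_nonneg) (auto intro: summable_ignore_initial_segment)
  have diff: "L2_norm M (\<lambda>x. s (m + N) x - s N x) \<le> tail N" for m N
  proof -
    have "(\<lambda>x. s (m + N) x - s N x) = (\<lambda>x. \<Sum>n<m. f (n + N) x)"
    proof
      show "s (m + N) x - s N x = (\<Sum>n<m. f (n + N) x)" for x
        unfolding s_def by (induction m) auto
    qed
    then have "L2_norm M (\<lambda>x. s (m + N) x - s N x) \<le> (\<Sum>n<m. L2_norm M (f (n + N)))"
      using f by (simp add: L2_norm_sum)
    also have "\<dots> \<le> tail N"
      unfolding tail_def using sm by (intro sum_le_suminf) (auto intro: summable_ignore_initial_segment)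
    finally show ?thesis .
  qed
  \<comment> \<open>For fixed \<open>N\<close>, Fatou's lemma is applied in \<open>m\<close> to
    \<open>s (m + N) - s N\<close>, whose norms are all at most \<open>tail N\<close>.\<close>
  have bound: "(\<integral>\<^sup>+x. ennreal ((cmod (g x - s N x))\<^sup>2) \<partial>M) \<le> ennreal ((tail N)\<^sup>2)" for N
  proof -
    have "(\<integral>\<^sup>+x. ennreal ((cmod (g x - s N x))\<^sup>2) \<partial>M)
        = (\<integral>\<^sup>+x. liminf (\<lambda>m. ennreal ((cmod (s (m + N) x - s N x))\<^sup>2)) \<partial>M)"
    proof (rule nn_integral_cong_AE, use lim in eventually_elim)
      case (elim x)
      then have "(\<lambda>m. s (m + N) x) \<longlonglongrightarrow> g x"
        by (rule LIMSEQ_ignore_initial_segment)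
      then have "(\<lambda>m. ennreal ((cmod (s (m + N) x - s N x))\<^sup>2)) \<longlonglongrightarrow> ennreal ((cmod (g x - s N x))\<^sup>2)"
        by (intro tendsto_intros)
      from lim_imp_Liminf[OF sequentially_bot this] show ?case
        by simp
    qed
    also have "\<dots> \<le> liminf (\<lambda>m. \<integral>\<^sup>+x. ennreal ((cmod (s (m + N) x - s N x))\<^sup>2) \<partial>M)"
      by (rule nn_integral_liminf) measurable
    also have "\<dots> \<le> ennreal ((tail N)\<^sup>2)"
    proof (rule Liminf_le)
      show "\<forall>\<^sub>F m in sequentially. (\<integral>\<^sup>+x. ennreal ((cmod (s (m + N) x - s N x))\<^sup>2) \<partial>M) \<le> ennreal ((tail N)\<^sup>2)"
        by (intro always_eventually allI)
          (auto simp: nn_integral_L2_norm[OF L2_diff[OF s_L2 s_L2]] intro!: ennreal_leI power_mono diff)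
    qed simp
    finally show ?thesis .
  qed
  have gs: "(\<lambda>x. g x - s N x) \<in> L2 M" for N
    using le_less_trans[OF bound] by (auto simp: L2_iff_nn_integral)
  have le: "L2_norm M (\<lambda>x. g x - s N x) \<le> tail N" for N
  proof -
    have "(L2_norm M (\<lambda>x. g x - s N x))\<^sup>2 \<le> (tail N)\<^sup>2"
      using bound[of N] by (simp add: nn_integral_L2_norm[OF gs])
    then show ?thesis
      using tail_nonneg by (rule power2_le_imp_le)
  qed
  have "tail \<longlonglongrightarrow> 0"
    unfolding tail_def using sm by (rule suminf_exist_split2)
  then have "(\<lambda>N. L2_norm M (\<lambda>x. g x - s N x)) \<longlonglongrightarrow> 0"
    by (rule tendsto_sandwich[rotated 3]) (auto simp: le)
  moreover have "g \<in> L2 M"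
    using gs[of 0] by (simp add: s_def)
  ultimately show ?thesis
    using that unfolding s_def by blast
qed

end

section \<open>Resolvents and spectral bounds\<close>

lemma bounded_op_L2: "bounded_op M T \<Longrightarrow> f \<in> L2 M \<Longrightarrow> T f \<in> L2 M"
  by (simp add: bounded_op_def)

lemma bounded_op_add:
  "bounded_op M T \<Longrightarrow> f \<in> L2 M \<Longrightarrow> g \<in> L2 M \<Longrightarrow> AE x in M. T (\<lambda>x. f x + g x) x = T f x + T g x"
  by (simp add: bounded_op_def)

lemma bounded_op_scale:
  "bounded_op M T \<Longrightarrow> f \<in> L2 M \<Longrightarrow> AE x in M. T (\<lambda>x. c * f x) x = c * T f x"
  by (simp add: bounded_op_def)

lemma bounded_opI:
  assumes "\<And>f. f \<in> L2 M \<Longrightarrow> T f \<in> L2 M"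
    and "\<And>f g. f \<in> L2 M \<Longrightarrow> g \<in> L2 M \<Longrightarrow> AE x in M. T (\<lambda>x. f x + g x) x = T f x + T g x"
    and "\<And>f c. f \<in> L2 M \<Longrightarrow> AE x in M. T (\<lambda>x. c * f x) x = c * T f x"
    and bound: "\<And>f. f \<in> L2 M \<Longrightarrow> L2_norm M (T f) \<le> C * L2_norm M f"
  shows "bounded_op M T"
  unfolding bounded_op_def
proof (intro conjI allI ballI)
  show "\<exists>C. \<forall>f\<in>L2 M. L2_norm M (T f) \<le> C * L2_norm M f"
    using bound by blast
qed (fact assms)+

lemma bounded_op_diff:
  assumes T: "bounded_op M T" and f: "f \<in> L2 M" and g: "g \<in> L2 M"
  shows "AE x in M. T (\<lambda>x. f x - g x) x = T f x - T g x"
  using bounded_op_add[OF T f L2_scale[OF g, of "-1"]] bounded_op_scale[OF T g, of "-1"]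
  by eventually_elim simp

text \<open>Operators act on representatives, so compatibility with almost-everywhere equality has
  to be derived: the difference has norm zero, and the norm bound carries this over to its
  image.\<close>

lemma bounded_op_cong_AE:
  assumes T: "bounded_op M T" and f: "f \<in> L2 M" and g: "g \<in> L2 M" and eq: "AE x in M. f x = g x"
  shows "AE x in M. T f x = T g x"
proof -
  let ?h = "\<lambda>x. f x - g x"
  have h: "?h \<in> L2 M"
    using f g by (rule L2_diff)
  have "AE x in M. ?h x = 0"
    using eq by eventually_elim simp
  then have "L2_norm M ?h = 0"
    using L2_norm_eq_0_iff[OF h] by simp
  moreover obtain C where "\<forall>f\<in>L2 M. L2_norm M (T f) \<le> C * L2_norm M f"
    using T by (auto simp: bounded_op_def)
  ultimately have "L2_norm M (T ?h) \<le> C * 0"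
    using h by metis
  then have "L2_norm M (T ?h) = 0"
    by (intro antisym) auto
  then have "AE x in M. T ?h x = 0"
    using L2_norm_eq_0_iff[OF bounded_op_L2[OF T h]] by simp
  with bounded_op_diff[OF T f g] show ?thesis
    by eventually_elim simp
qed

lemma bounded_op_comp:
  assumes T: "bounded_op M T" and S: "bounded_op M S"
  shows "bounded_op M (T \<circ> S)"
proof -
  obtain C where C: "\<forall>f\<in>L2 M. L2_norm M (T f) \<le> C * L2_norm M f"
    using T by (auto simp: bounded_op_def)
  obtain D where D: "\<forall>f\<in>L2 M. L2_norm M (S f) \<le> D * L2_norm M f"
    using S by (auto simp: bounded_op_def)
  have "L2_norm M (T (S f)) \<le> (\<bar>C\<bar> * D) * L2_norm M f" if f: "f \<in> L2 M" for f
  proof -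
    have "L2_norm M (T (S f)) \<le> C * L2_norm M (S f)"
      using C bounded_op_L2[OF S f] by simp
    also have "\<dots> \<le> \<bar>C\<bar> * L2_norm M (S f)"
      by (simp add: mult_right_mono)
    also have "\<dots> \<le> \<bar>C\<bar> * (D * L2_norm M f)"
      using D f by (intro mult_left_mono) auto
    finally show ?thesis by (simp add: mult.assoc)
  qed
  note norm = this
  have add: "AE x in M. T (S (\<lambda>x. f x + g x)) x = T (S f) x + T (S g) x"
    if f: "f \<in> L2 M" and g: "g \<in> L2 M" for f g
    using bounded_op_cong_AE[OF T _ _ bounded_op_add[OF S f g]]
      bounded_op_add[OF T bounded_op_L2[OF S f] bounded_op_L2[OF S g]] f g S
    by (auto simp: bounded_op_L2 L2_add)
  have scale: "AE x in M. T (S (\<lambda>x. c * f x)) x = c * T (S f) x" if f: "f \<in> L2 M" for f c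
    using bounded_op_cong_AE[OF T _ _ bounded_op_scale[OF S f, of c]]
      bounded_op_scale[OF T bounded_op_L2[OF S f], of c] f S
    by (auto simp: bounded_op_L2 L2_scale)
  show ?thesis
    unfolding o_def using bounded_op_L2[OF T bounded_op_L2[OF S]] add scale norm
    by (rule bounded_opI)
qed

lemma bounded_op_id: "bounded_op M id"
  unfolding bounded_op_def by (auto intro!: exI[of _ 1])

text \<open>An operator that is onto and bounded below has a bounded inverse. Preimages are picked
  by \<open>SOME\<close>; the lower bound makes them unique up to null sets, and uniqueness turns
  the choice into a linear map with bound \<open>C\<close>.\<close>

lemma is_resolvent_exists:
  assumes T: "bounded_op M T"
    and surj: "\<And>f. f \<in> L2 M \<Longrightarrow> \<exists>g\<in>L2 M. AE x in M. z * g x - T g x = f x"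
    and lower: "\<And>g. g \<in> L2 M \<Longrightarrow> L2_norm M g \<le> C * L2_norm M (\<lambda>x. z * g x - T g x)"
  shows "\<exists>R. is_resolvent M T z R"
proof -
  let ?A = "\<lambda>g x. z * g x - T g x"
  have A_L2: "?A g \<in> L2 M" if "g \<in> L2 M" for g
    by (intro L2_diff L2_scale bounded_op_L2[OF T] that)
  have A_add: "AE x in M. ?A (\<lambda>x. g x + h x) x = ?A g x + ?A h x" if "g \<in> L2 M" "h \<in> L2 M" for g h
    using bounded_op_add[OF T that] by eventually_elim (simp add: algebra_simps)
  have A_scale: "AE x in M. ?A (\<lambda>x. c * g x) x = c * ?A g x" if "g \<in> L2 M" for g c
    using bounded_op_scale[OF T that, of c] by eventually_elim (simp add: algebra_simps)
  have A_inj: "AE x in M. g x = h x"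
    if g: "g \<in> L2 M" and h: "h \<in> L2 M" and eq: "AE x in M. ?A g x = ?A h x" for g h
  proof -
    let ?d = "\<lambda>x. g x - h x"
    have d: "?d \<in> L2 M" using g h by (rule L2_diff)
    have "AE x in M. ?A ?d x = 0"
      using eq bounded_op_diff[OF T g h]
    proof eventually_elim
      case (elim x)
      show ?case
        using elim(1) unfolding elim(2) by (simp add: algebra_simps)
    qed
    then have "L2_norm M (?A ?d) = 0"
      using L2_norm_eq_0_iff[OF A_L2[OF d]] by simp
    then have "L2_norm M ?d = 0"
      using lower[OF d] by (intro antisym) auto
    then show ?thesis
      using L2_norm_eq_0_iff[OF d] by simp
  qed
  define R where "R f = (SOME g. g \<in> L2 M \<and> (AE x in M. ?A g x = f x))" for f
  have R: "R f \<in> L2 M" "AE x in M. ?A (R f) x = f x" if "f \<in> L2 M" for f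
  proof -
    have "\<exists>g. g \<in> L2 M \<and> (AE x in M. ?A g x = f x)"
      using surj[OF that] by blast
    from someI_ex[OF this] show "R f \<in> L2 M" "AE x in M. ?A (R f) x = f x"
      unfolding R_def by auto
  qed
  have R_add: "AE x in M. R (\<lambda>x. f x + g x) x = R f x + R g x" if f: "f \<in> L2 M" and g: "g \<in> L2 M" for f g
  proof (rule A_inj)
    show "AE x in M. ?A (R (\<lambda>x. f x + g x)) x = ?A (\<lambda>x. R f x + R g x) x"
      using R(2)[OF L2_add[OF f g]] R(2)[OF f] R(2)[OF g] A_add[OF R(1)[OF f] R(1)[OF g]]
      by eventually_elim simp
  qed (intro R L2_add f g)+
  have R_scale: "AE x in M. R (\<lambda>x. c * f x) x = c * R f x" if f: "f \<in> L2 M" for f c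
  proof (rule A_inj)
    show "AE x in M. ?A (R (\<lambda>x. c * f x)) x = ?A (\<lambda>x. c * R f x) x"
      using R(2)[OF L2_scale[OF f]] R(2)[OF f] A_scale[OF R(1)[OF f], of c]
      by eventually_elim simp
  qed (intro R L2_scale f)+
  have R_norm: "L2_norm M (R f) \<le> C * L2_norm M f" if f: "f \<in> L2 M" for f
  proof -
    have "L2_norm M (?A (R f)) = L2_norm M f"
      using R[OF f] f A_L2 by (intro L2_norm_cong_AE) auto
    then show ?thesis
      using lower[OF R(1)[OF f]] by simp
  qed
  have R_A: "AE x in M. R (?A f) x = f x" if f: "f \<in> L2 M" for f
    using R[OF A_L2[OF f]] f by (intro A_inj[of "R (?A f)" f])
  have "bounded_op M R"
    using R(1) R_add R_scale R_norm by (rule bounded_opI)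
  have "is_resolvent M T z R"
    unfolding is_resolvent_def using \<open>bounded_op M R\<close> R_A R(2) by simp
  then show ?thesis
    by (rule exI[of _ R])
qed

text \<open>This is the triangle inequality for \<open>z g = (z g - T g) + T g\<close>.\<close>

lemma L2_norm_resolvent_ge:
  assumes T: "bounded_op M T" and c: "L2_norm M (T g) \<le> c * L2_norm M g" and g: "g \<in> L2 M"
  shows "(cmod z - c) * L2_norm M g \<le> L2_norm M (\<lambda>x. z * g x - T g x)"
proof -
  have "L2_norm M (\<lambda>x. (z * g x - T g x) + T g x)
      \<le> L2_norm M (\<lambda>x. z * g x - T g x) + L2_norm M (T g)"
    by (intro L2_norm_triangle L2_diff L2_scale bounded_op_L2[OF T] g)
  then show ?thesis
    using c by (simp add: L2_norm_scale algebra_simps)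
qed

text \<open>The solution is the sum of \<open>T^n f / z^(n+1)\<close>, whose norms decay like powers
  of \<open>c / |z| < 1\<close>.\<close>

lemma (in prob_space) Neumann_series_solution:
  assumes T: "bounded_op M T" and c: "\<And>f. f \<in> L2 M \<Longrightarrow> L2_norm M (T f) \<le> c * L2_norm M f"
    and c0: "0 \<le> c" and z: "c < cmod z" and f: "f \<in> L2 M"
  shows "\<exists>g\<in>L2 M. AE x in M. z * g x - T g x = f x"
proof -
  define p where "p n = (T ^^ n) f" for n
  have p_Suc: "p (Suc n) = T (p n)" for n
    by (simp add: p_def)
  have p: "p n \<in> L2 M \<and> L2_norm M (p n) \<le> c ^ n * L2_norm M f" for n
  proof (induction n)
    case (Suc n)
    then have "L2_norm M (p (Suc n)) \<le> c * (c ^ n * L2_norm M f)"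
      unfolding p_Suc using c[of "p n"] c0 by (meson mult_left_mono order_trans)
    with Suc T show ?case
      by (simp add: p_Suc bounded_op_L2)
  qed (simp add: f p_def)
  define h where "h n x = (1 / z) ^ Suc n * p n x" for n x
  have h: "h n \<in> L2 M" for n
    unfolding h_def using p by (intro L2_scale) simp
  have z0: "z \<noteq> 0" "0 < cmod z"
    using z c0 by auto
  let ?r = "c / cmod z"
  have r: "0 \<le> ?r" "?r < 1"
    using z0 c0 z by auto
  have scaled: "cmod ((1 / z) ^ n) * L2_norm M (p n) \<le> ?r ^ n * L2_norm M f" for n
  proof -
    have "cmod ((1 / z) ^ n) * L2_norm M (p n) \<le> cmod ((1 / z) ^ n) * (c ^ n * L2_norm M f)"
      using p by (intro mult_left_mono) auto
    also have "\<dots> = ?r ^ n * L2_norm M f"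
      by (simp add: norm_power norm_divide power_divide)
    finally show ?thesis .
  qed
  have h_norm: "L2_norm M (h n) \<le> ?r ^ n * (L2_norm M f / cmod z)" for n
  proof -
    have "L2_norm M (h n) = (cmod ((1 / z) ^ n) * L2_norm M (p n)) / cmod z"
      unfolding h_def L2_norm_scale by (simp add: norm_mult norm_divide)
    also have "\<dots> \<le> (?r ^ n * L2_norm M f) / cmod z"
      using scaled by (intro divide_right_mono) auto
    finally show ?thesis by simp
  qed
  have "summable (\<lambda>n. L2_norm M (h n))"
  proof (rule summable_comparison_test)
    show "summable (\<lambda>n. ?r ^ n * (L2_norm M f / cmod z))"
      using r by (intro summable_mult2 summable_geometric) auto
  qed (use h_norm in auto)
  then obtain g where g: "g \<in> L2 M"
    and lim: "(\<lambda>N. L2_norm M (\<lambda>x. g x - (\<Sum>n<N. h n x))) \<longlonglongrightarrow> 0"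
    using L2_complete[of h] h by blast
  define S where "S N x = (\<Sum>n<N. h n x)" for N x
  have S: "S N \<in> L2 M" for N
    unfolding S_def using h by (intro L2_sum)
  \<comment> \<open>The partial sums solve the equation up to the defect
    \<open>z^(-N) T^N f\<close>. Linearity of \<open>T\<close> holds only almost everywhere, hence
    so does this identity.\<close>
  have telescope: "AE x in M. z * S N x - T (S N) x = f x - (1 / z) ^ N * p N x" for N
  proof (induction N)
    case 0
    have "AE x in M. T (\<lambda>x. 0 * f x) x = 0 * T f x"
      by (rule bounded_op_scale[OF T f])
    then show ?case
      by eventually_elim (simp add: S_def p_def)
  next
    case (Suc N)
    have Suc_eq: "S (Suc N) = (\<lambda>x. S N x + h N x)"
      by (rule ext) (simp add: S_def)
    have hN: "h N = (\<lambda>x. (1 / z) ^ Suc N * p N x)"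
      by (rule ext) (simp add: h_def)
    have "AE x in M. T (h N) x = (1 / z) ^ Suc N * T (p N) x"
      unfolding hN using p[of N] by (intro bounded_op_scale[OF T]) simp
    with Suc bounded_op_add[OF T S[of N] h[of N]] show ?case
    proof eventually_elim
      case (elim x)
      have "z * h N x = (1 / z) ^ N * p N x"
        using z0 by (simp add: h_def)
      then show ?case
        using elim by (simp add: Suc_eq p_Suc algebra_simps)
    qed
  qed
  let ?d = "\<lambda>x. (z * g x - T g x) - f x"
  have d: "?d \<in> L2 M"
    by (intro L2_diff L2_scale bounded_op_L2[OF T] f g)
  define e where "e N = L2_norm M (\<lambda>x. g x - S N x)" for N
  \<comment> \<open>The defect of \<open>g\<close> is that of the partial sum plus
    \<open>z - T\<close> applied to \<open>g - S N\<close>; the three resulting norms all tend to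
    zero with \<open>N\<close>.\<close>
  have "L2_norm M ?d \<le> cmod z * e N + c * e N + ?r ^ N * L2_norm M f" for N
  proof -
    let ?u = "\<lambda>x. g x - S N x"
    have u: "?u \<in> L2 M"
      using g S by (rule L2_diff)
    have Tu: "T ?u \<in> L2 M"
      using T u by (rule bounded_op_L2)
    have zp: "(\<lambda>x. (1 / z) ^ N * p N x) \<in> L2 M"
      using p by (intro L2_scale) simp
    have "L2_norm M ?d = L2_norm M (\<lambda>x. (z * ?u x - T ?u x) - (1 / z) ^ N * p N x)"
    proof (rule L2_norm_cong_AE)
      show "AE x in M. ?d x = (z * ?u x - T ?u x) - (1 / z) ^ N * p N x"
        using telescope[of N] bounded_op_diff[OF T g S[of N]]
      proof eventually_elim
        case (elim x)
        have "f x = z * S N x - T (S N) x + (1 / z) ^ N * p N x"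
          using elim(1) by simp
        then show ?case
          unfolding elim(2) by (simp add: algebra_simps)
      qed
    qed (use d L2_diff[OF L2_diff[OF L2_scale[OF u] Tu] zp] in auto)
    also have "\<dots> \<le> (L2_norm M (\<lambda>x. z * ?u x) + L2_norm M (T ?u)) + L2_norm M (\<lambda>x. (1 / z) ^ N * p N x)"
      by (rule order_trans[OF L2_norm_triangle_diff add_right_mono[OF L2_norm_triangle_diff]])
         (intro L2_diff L2_scale u Tu zp)+
    also have "\<dots> \<le> (cmod z * e N + c * e N) + ?r ^ N * L2_norm M f"
      using c[OF u] scaled[of N] unfolding e_def L2_norm_scale by (intro add_mono) auto
    finally show ?thesis .
  qed
  moreover have "(\<lambda>N. cmod z * e N + c * e N + ?r ^ N * L2_norm M f)
      \<longlonglongrightarrow> cmod z * 0 + c * 0 + 0 * L2_norm M f"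
    using lim r unfolding e_def S_def by (intro tendsto_intros LIMSEQ_power_zero) auto
  ultimately have "L2_norm M ?d \<le> 0"
    by (intro LIMSEQ_le_const[of _ 0]) auto
  then have "L2_norm M ?d = 0"
    by (intro antisym) auto
  then have "AE x in M. ?d x = 0"
    using L2_norm_eq_0_iff[OF d] by simp
  then have "AE x in M. z * g x - T g x = f x"
    by eventually_elim simp
  with g show ?thesis by blast
qed

text \<open>These properties of kernel operators survive composition and carry the spectral
  estimates, so a product of powers of two kernel operators can be treated without exhibiting it as
  the operator of a kernel. Preservation of the mean reflects invariance of the measure, the last
  clause total mass one.\<close>

definition markov_op :: "'a measure \<Rightarrow> (('a \<Rightarrow> complex) \<Rightarrow> 'a \<Rightarrow> complex) \<Rightarrow> bool" where
  "markov_op M T \<longleftrightarrow> bounded_op M T \<and>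
     (\<forall>f\<in>L2 M. L2_norm M (T f) \<le> L2_norm M f \<and> (\<integral>x. T f x \<partial>M) = (\<integral>x. f x \<partial>M)) \<and>
     (\<forall>c. AE x in M. T (\<lambda>_. c) x = c)"

lemma markov_op_id: "markov_op M id"
  by (simp add: markov_op_def bounded_op_id)

lemma (in prob_space) markov_op_comp:
  assumes T: "markov_op M T" and S: "markov_op M S"
  shows "markov_op M (T \<circ> S)"
proof -
  have Sf: "S f \<in> L2 M" if "f \<in> L2 M" for f
    using S that by (auto simp: markov_op_def bounded_op_L2)
  have "AE x in M. T (S (\<lambda>_. c)) x = c" for c
  proof -
    have "AE x in M. T (S (\<lambda>_. c)) x = T (\<lambda>_. c) x"
      using S T Sf by (intro bounded_op_cong_AE[of M T]) (auto simp: markov_op_def)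
    moreover have "AE x in M. T (\<lambda>_. c) x = c"
      using T by (auto simp: markov_op_def)
    ultimately show ?thesis by eventually_elim simp
  qed
  moreover have "L2_norm M (T (S f)) \<le> L2_norm M f" "(\<integral>x. T (S f) x \<partial>M) = (\<integral>x. f x \<partial>M)"
    if "f \<in> L2 M" for f
    using S T Sf[OF that] that by (auto simp: markov_op_def intro: order_trans)
  ultimately show ?thesis
    using S T by (auto simp: markov_op_def intro: bounded_op_comp)
qed

lemma (in prob_space) markov_op_funpow: "markov_op M T \<Longrightarrow> markov_op M (T ^^ n)"
  by (induction n) (auto simp: markov_op_id markov_op_comp)

text \<open>\<open>L2\<close> splits into the constants, where \<open>T\<close> is the identity, and
  the mean-zero functions, which \<open>T\<close> preserves and contracts by \<open>c\<close>. Hence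
  every spectral value other than 1 comes from the second summand, and for \<open>c < 1\<close> the
  mean-zero part of a fixed vector vanishes.\<close>

lemma (in prob_space)
  assumes T: "markov_op M T"
    and c: "\<And>f. f \<in> L2 M \<Longrightarrow> (\<integral>x. f x \<partial>M) = 0 \<Longrightarrow> L2_norm M (T f) \<le> c * L2_norm M f"
  shows spectrum_L2_bound: "0 \<le> c \<Longrightarrow> z \<in> spectrum_L2 M T \<Longrightarrow> z \<noteq> 1 \<Longrightarrow> cmod z \<le> c"
    and eigenvalue_1_simpleI: "c < 1 \<Longrightarrow> eigenvalue_1_simple M T"
proof -
  have bT: "bounded_op M T" and T_int: "f \<in> L2 M \<Longrightarrow> (\<integral>x. T f x \<partial>M) = (\<integral>x. f x \<partial>M)"
    and T_const: "AE x in M. T (\<lambda>_. a) x = a" for f a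
    using T by (auto simp: markov_op_def)
  let ?E = "\<lambda>f. (\<integral>x. f x \<partial>M) :: complex"
  have T_centred: "AE x in M. T (\<lambda>x. f x - ?E f) x = T f x - ?E f" if "f \<in> L2 M" for f
    using bounded_op_diff[OF bT that L2_const[of "?E f"]] T_const[of "?E f"] by eventually_elim simp
  have centred: "(\<lambda>x. f x - ?E f) \<in> L2 M" "?E (\<lambda>x. f x - ?E f) = 0" if "f \<in> L2 M" for f
    using that by (auto simp: L2_diff L2_integrable prob_space)
  \<comment> \<open>Centring is an orthogonal projection: the squared norm drops by exactly
    \<open>|?E f|^2\<close>.\<close>
  have centred_le: "L2_norm M (\<lambda>x. f x - ?E f) \<le> L2_norm M f" if f: "f \<in> L2 M" for f
  proof -
    have "(\<integral>x. (f x - ?E f) * cnj (f x - ?E f) \<partial>M) = (\<integral>x. (f x * cnj (f x) - cnj (?E f) * f x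
        - ?E f * cnj (f x)) + ?E f * cnj (?E f) \<partial>M)"
      by (intro Bochner_Integration.integral_cong) (auto simp: algebra_simps)
    also have "\<dots> = (\<integral>x. f x * cnj (f x) \<partial>M) - ?E f * cnj (?E f)"
      using L2_integrable_mult[OF f f] L2_integrable[OF f] by (simp add: prob_space)
    finally have "L2_inner M (\<lambda>x. f x - ?E f) (\<lambda>x. f x - ?E f) = L2_inner M f f - ?E f * cnj (?E f)"
      unfolding L2_inner_def .
    then have "complex_of_real ((L2_norm M (\<lambda>x. f x - ?E f))\<^sup>2)
        = complex_of_real ((L2_norm M f)\<^sup>2 - (cmod (?E f))\<^sup>2)"
      unfolding L2_inner_self complex_norm_square[symmetric] by simp
    then have "(L2_norm M (\<lambda>x. f x - ?E f))\<^sup>2 = (L2_norm M f)\<^sup>2 - (cmod (?E f))\<^sup>2"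
      unfolding of_real_eq_iff .
    then have "(L2_norm M (\<lambda>x. f x - ?E f))\<^sup>2 \<le> (L2_norm M f)\<^sup>2"
      by simp
    then show ?thesis
      by (rule power2_le_imp_le) simp
  qed
  show "eigenvalue_1_simple M T" if "c < 1"
    unfolding eigenvalue_1_simple_def
  proof (intro bexI[of _ "\<lambda>_. 1"] conjI ballI impI)
    show "AE x in M. T (\<lambda>_. 1) x = 1"
      by (rule T_const)
    show "\<not> (AE x in M. (1::complex) = 0)"
      by (simp add: AE_False)
    fix f assume f: "f \<in> L2 M" and eq: "AE x in M. T f x = f x"
    let ?f = "\<lambda>x. f x - ?E f"
    have "AE x in M. T ?f x = ?f x"
      using T_centred[OF f] eq by eventually_elim simp
    then have "L2_norm M (T ?f) = L2_norm M ?f"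
      using centred[OF f] bounded_op_L2[OF bT centred(1)[OF f]] by (intro L2_norm_cong_AE) auto
    then have "L2_norm M ?f \<le> c * L2_norm M ?f"
      using c[OF centred[OF f]] by simp
    then have "(1 - c) * L2_norm M ?f \<le> 0"
      by (simp add: algebra_simps)
    then have "L2_norm M ?f = 0"
      using that by (intro antisym) (auto simp: mult_le_0_iff)
    then have "AE x in M. ?f x = 0"
      using L2_norm_eq_0_iff[OF centred(1)[OF f]] by simp
    then show "\<exists>a. AE x in M. f x = a * 1"
      by (intro exI[of _ "?E f"]) (auto simp: algebra_simps)
  qed simp
  show "cmod z \<le> c" if c0: "0 \<le> c" and z: "z \<in> spectrum_L2 M T" "z \<noteq> 1"
  proof (rule ccontr)
    assume "\<not> cmod z \<le> c"
    then have zc: "c < cmod z" by simp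
    \<comment> \<open>Removing the rank-one projection onto constants gives an operator of norm at most \<open>c\<close> on all
      of \<open>L\<^sub>2\<close>, to which the Neumann series applies.\<close>
    define S where "S f x = T f x - ?E f" for f x
    have S_centred: "AE x in M. S f x = T (\<lambda>x. f x - ?E f) x" if "f \<in> L2 M" for f
      using T_centred[OF that] by eventually_elim (simp add: S_def)
    have S_L2: "S f \<in> L2 M" if "f \<in> L2 M" for f
      unfolding S_def by (intro L2_diff bounded_op_L2[OF bT] L2_const that)
    have S_norm: "L2_norm M (S f) \<le> c * L2_norm M f" if f: "f \<in> L2 M" for f
    proof -
      have "L2_norm M (S f) = L2_norm M (T (\<lambda>x. f x - ?E f))"
        using S_centred[OF f] S_L2[OF f] bounded_op_L2[OF bT centred(1)[OF f]]
        by (intro L2_norm_cong_AE) auto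
      also have "\<dots> \<le> c * L2_norm M (\<lambda>x. f x - ?E f)"
        using centred[OF f] by (rule c)
      also have "\<dots> \<le> c * L2_norm M f"
        using centred_le[OF f] c0 by (rule mult_left_mono)
      finally show ?thesis .
    qed
    have S_add: "AE x in M. S (\<lambda>x. f x + g x) x = S f x + S g x" if "f \<in> L2 M" "g \<in> L2 M" for f g
      using bounded_op_add[OF bT that]
      by eventually_elim (simp add: S_def L2_integrable that)
    have S_scale: "AE x in M. S (\<lambda>x. a * f x) x = a * S f x" if "f \<in> L2 M" for f a
      using bounded_op_scale[OF bT that, of a] by eventually_elim (simp add: S_def algebra_simps)
    have bS: "bounded_op M S"
      using S_L2 S_add S_scale S_norm by (rule bounded_opI)
    \<comment> \<open>On means \<open>z - T\<close> acts as multiplication by \<open>z - 1\<close>,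
      which is invertible because \<open>z\<close> differs from 1.\<close>
    have mean: "?E (\<lambda>x. z * g x - T g x) = (z - 1) * ?E g" if g: "g \<in> L2 M" for g
      using g bounded_op_L2[OF bT g] by (simp add: L2_integrable T_int algebra_simps)
    have "\<exists>R. is_resolvent M T z R"
    proof (rule is_resolvent_exists[OF bT])
      fix f assume f: "f \<in> L2 M"
      obtain g where g: "g \<in> L2 M" and eq: "AE x in M. z * g x - S g x = f x"
        using Neumann_series_solution[OF bS S_norm c0 zc f] by blast
      \<comment> \<open>From \<open>z g - S g = f\<close> one gets
        \<open>z g - T g = f - ?E g\<close>; adding a constant \<open>?a\<close> to \<open>g\<close>
        contributes \<open>(z - 1) ?a\<close>, which has to equal \<open>?E g\<close>.\<close>
      let ?a = "?E g / (z - 1)"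
      have "AE x in M. z * (g x + ?a) - T (\<lambda>x. g x + ?a) x = f x"
        using eq bounded_op_add[OF bT g L2_const[of ?a]] T_const[of ?a]
      proof eventually_elim
        case (elim x)
        have "z * ?a = ?a + ?a * (z - 1)" by (simp only: ring_distribs mult_1 mult.commute) simp
        also have "?a * (z - 1) = ?E g" using z by simp
        finally have "z * ?a = ?a + ?E g" .
        then show ?case
          using elim by (simp add: S_def algebra_simps)
      qed
      then show "\<exists>g\<in>L2 M. AE x in M. z * g x - T g x = f x"
        using L2_add[OF g L2_const[of ?a]] by (rule bexI)
    next
      fix g assume g: "g \<in> L2 M"
      let ?h = "\<lambda>x. z * g x - T g x"
      have h: "?h \<in> L2 M"
        by (intro L2_diff L2_scale bounded_op_L2[OF bT] g)
      \<comment> \<open>The lower bound for \<open>z - T\<close> is derived from the one for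
        \<open>z - S\<close>: the two differ by the constant \<open>?E g\<close>, and this mean is
        controlled by the mean of \<open>?h\<close>.\<close>
      have "cmod (z - 1) * cmod (?E g) = cmod (?E ?h)"
        using mean[OF g] by (simp add: norm_mult)
      then have "cmod (?E g) = cmod (?E ?h) / cmod (z - 1)"
        using z by (simp add: field_simps)
      also have "\<dots> \<le> L2_norm M ?h / cmod (z - 1)"
        using integral_le_L2_norm[OF h] by (intro divide_right_mono) auto
      finally have Eg: "cmod (?E g) \<le> L2_norm M ?h / cmod (z - 1)" .
      have "(cmod z - c) * L2_norm M g \<le> L2_norm M (\<lambda>x. z * g x - S g x)"
        using bS S_norm[OF g] g by (rule L2_norm_resolvent_ge)
      also have "(\<lambda>x. z * g x - S g x) = (\<lambda>x. ?h x + ?E g)"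
        by (simp add: S_def algebra_simps)
      also have "L2_norm M \<dots> \<le> L2_norm M ?h + cmod (?E g)"
        using L2_norm_triangle[OF h L2_const[of "?E g"]] by simp
      also have "\<dots> \<le> (1 + 1 / cmod (z - 1)) * L2_norm M ?h"
        using Eg by (simp add: algebra_simps)
      finally have "L2_norm M g \<le> (1 + 1 / cmod (z - 1)) * L2_norm M ?h / (cmod z - c)"
        using zc by (simp add: field_simps)
      then show "L2_norm M g \<le> ((1 + 1 / cmod (z - 1)) / (cmod z - c)) * L2_norm M ?h"
        by simp
    qed
    then show False
      using z by (simp add: spectrum_L2_def)
  qed
qed

section \<open>Density of Lipschitz functions with bounded support\<close>

lemma L2_dominated_convergence:
  assumes w: "w \<in> L2 M" and [measurable]: "f \<in> borel_measurable M" "\<And>n. s n \<in> borel_measurable M"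
    and f: "\<And>x. cmod (f x) \<le> cmod (w x)" and s: "\<And>n x. cmod (s n x) \<le> cmod (w x)"
    and lim: "\<And>x. x \<in> space M \<Longrightarrow> (\<lambda>n. s n x) \<longlonglongrightarrow> f x"
  shows "(\<lambda>n. L2_norm M (\<lambda>x. f x - s n x)) \<longlonglongrightarrow> 0"
proof -
  have "(\<lambda>n. \<integral>x. (cmod (f x - s n x))\<^sup>2 \<partial>M) \<longlonglongrightarrow> (\<integral>x. 0 \<partial>M)"
  proof (rule integral_dominated_convergence)
    \<comment> \<open>The factor 4 is the square of the 2 in
      \<open>|f - s n| \<le> 2 |w|\<close>.\<close>
    show "integrable M (\<lambda>x. 4 * (cmod (w x))\<^sup>2)"
      using L2_integrable_power2[OF w] by simp
    show "AE x in M. (\<lambda>n. (cmod (f x - s n x))\<^sup>2) \<longlonglongrightarrow> 0"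
    proof (rule AE_I2)
      fix x assume "x \<in> space M"
      from tendsto_power[OF tendsto_norm[OF tendsto_diff[OF tendsto_const[of "f x"] lim[OF this]]], of 2]
      show "(\<lambda>n. (cmod (f x - s n x))\<^sup>2) \<longlonglongrightarrow> 0" by simp
    qed
    show "AE x in M. norm ((cmod (f x - s n x))\<^sup>2) \<le> 4 * (cmod (w x))\<^sup>2" for n
    proof (rule AE_I2)
      fix x
      have "cmod (f x - s n x) \<le> 2 * cmod (w x)"
        using norm_triangle_ineq4[of "f x" "s n x"] f[of x] s[of n x] by simp
      from power_mono[OF this, of 2] show "norm ((cmod (f x - s n x))\<^sup>2) \<le> 4 * (cmod (w x))\<^sup>2"
        by (simp add: power_mult_distrib)
    qed
  qed auto
  then have "(\<lambda>n. sqrt (\<integral>x. (cmod (f x - s n x))\<^sup>2 \<partial>M)) \<longlonglongrightarrow> sqrt 0"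
    by (intro tendsto_real_sqrt) simp
  then show ?thesis
    unfolding L2_norm_def by simp
qed

text \<open>Bounded support makes a Lipschitz function bounded, hence square integrable under any
  probability measure. It also means that pairing with such a function sees another function only on
  a bounded set, where a Lipschitz constant controls the oscillation.\<close>

definition lipschitz_bs :: "('a::metric_space \<Rightarrow> complex) set" where
  "lipschitz_bs = {f. (\<exists>C. C-lipschitz_on UNIV f) \<and> bounded {x. f x \<noteq> 0}}"

lemma lipschitz_bs_add:
  assumes "f \<in> lipschitz_bs" "g \<in> lipschitz_bs"
  shows "(\<lambda>x. f x + g x) \<in> lipschitz_bs"
proof -
  have "bounded {x. f x + g x \<noteq> 0}"
    by (rule bounded_subset[of "{x. f x \<noteq> 0} \<union> {x. g x \<noteq> 0}"])
      (use assms in \<open>auto simp: lipschitz_bs_def\<close>)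
  moreover obtain C D where "C-lipschitz_on UNIV f" "D-lipschitz_on UNIV g"
    using assms by (auto simp: lipschitz_bs_def)
  then have "(C + D)-lipschitz_on UNIV (\<lambda>x. f x + g x)"
    by (rule lipschitz_on_add)
  ultimately show ?thesis
    by (auto simp: lipschitz_bs_def)
qed

lemma lipschitz_bs_scale:
  assumes "f \<in> lipschitz_bs"
  shows "(\<lambda>x. c * f x) \<in> lipschitz_bs"
proof -
  obtain C where C: "C-lipschitz_on UNIV f"
    using assms by (auto simp: lipschitz_bs_def)
  have "(cmod c * C)-lipschitz_on UNIV (\<lambda>x. c * f x)"
    using C unfolding lipschitz_on_def dist_norm
    by (simp add: norm_mult mult.assoc mult_left_mono flip: right_diff_distrib)
  moreover have "bounded {x. c * f x \<noteq> 0}"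
    by (rule bounded_subset[of "{x. f x \<noteq> 0}"]) (use assms in \<open>auto simp: lipschitz_bs_def\<close>)
  ultimately show ?thesis
    by (auto simp: lipschitz_bs_def)
qed

lemma lipschitz_bs_diff:
  "f \<in> lipschitz_bs \<Longrightarrow> g \<in> lipschitz_bs \<Longrightarrow> (\<lambda>x. f x - g x) \<in> lipschitz_bs"
  using lipschitz_bs_add[of f "\<lambda>x. (-1) * g x"] lipschitz_bs_scale[of g "-1"] by simp

lemma lipschitz_bs_measurable [measurable_dest]: "f \<in> lipschitz_bs \<Longrightarrow> f \<in> borel_measurable borel"
  by (auto simp: lipschitz_bs_def intro: borel_measurable_continuous_onI lipschitz_on_continuous_on)

lemma lipschitz_bs_bounded:
  assumes "f \<in> lipschitz_bs"
  obtains B where "\<And>x. cmod (f x) \<le> B"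
proof -
  obtain C where C: "C-lipschitz_on UNIV f"
    using assms by (auto simp: lipschitz_bs_def)
  have "bounded {x. f x \<noteq> 0}"
    using assms by (simp add: lipschitz_bs_def)
  \<comment> \<open>\<open>undefined\<close> serves as an arbitrary base point. For an empty support
    \<open>r\<close> may be negative, which is why \<open>\<bar>r\<bar>\<close> appears
    below.\<close>
  then obtain r where r: "\<forall>x\<in>{x. f x \<noteq> 0}. dist undefined x \<le> r"
    using bounded_any_center[of _ undefined] by blast
  have "cmod (f x) \<le> cmod (f undefined) + C * \<bar>r\<bar>" for x
  proof (cases "f x = 0")
    case False
    then have "dist undefined x \<le> \<bar>r\<bar>" using r by force
    have "cmod (f x) \<le> cmod (f undefined) + cmod (f x - f undefined)"
      by (metis add.commute norm_triangle_sub)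
    also have "cmod (f x - f undefined) \<le> C * dist x undefined"
      using lipschitz_onD[OF C, of x undefined] by (simp add: dist_norm)
    also have "C * dist x undefined \<le> C * \<bar>r\<bar>"
      using \<open>dist undefined x \<le> \<bar>r\<bar>\<close> lipschitz_on_nonneg[OF C]
      by (simp add: dist_commute mult_left_mono)
    finally show ?thesis by simp
  qed (use lipschitz_on_nonneg[OF C] in auto)
  then show thesis by (rule that)
qed

lemma lipschitz_bs_L2:
  assumes "prob_space M" "sets M = sets borel" "f \<in> lipschitz_bs"
  shows "f \<in> L2 M"
proof -
  interpret prob_space M by fact
  obtain B where "\<And>x. cmod (f x) \<le> B"
    using lipschitz_bs_bounded[OF assms(3)] by blast
  then show ?thesis
    using assms lipschitz_bs_measurable[OF assms(3)] by (intro L2_bounded) (auto cong: measurable_cong_sets)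
qed

text \<open>Tents of slope \<open>n + 1\<close> around \<open>K\<close>, supported in its unit
  neighbourhood. With slope \<open>n\<close> the case \<open>n = 0\<close> would be the constant 1,
  whose support is in general unbounded.\<close>

lemma lipschitz_bs_bump:
  fixes K :: "'a::metric_space set"
  assumes "bounded K" "K \<noteq> {}"
  shows "(\<lambda>x. complex_of_real (max 0 (1 - real (Suc n) * infdist x K))) \<in> lipschitz_bs"
proof -
  have "\<bar>infdist x K - infdist y K\<bar> \<le> dist x y" for x y
    using infdist_triangle[of x K y] infdist_triangle[of y K x] by (simp add: dist_commute abs_le_iff)
  then have "\<bar>real (Suc n) * infdist x K - real (Suc n) * infdist y K\<bar> \<le> real (Suc n) * dist x y" for x y
    unfolding right_diff_distrib[symmetric] abs_mult by (intro mult_mono) auto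
  then have "\<bar>max 0 (1 - real (Suc n) * infdist x K) - max 0 (1 - real (Suc n) * infdist y K)\<bar>
      \<le> real (Suc n) * dist x y" for x y
    by (smt (verit))
  then have "(real (Suc n))-lipschitz_on UNIV (\<lambda>x. complex_of_real (max 0 (1 - real (Suc n) * infdist x K)))"
    unfolding lipschitz_on_def dist_norm by (simp flip: of_real_diff del: of_nat_Suc)
  moreover have "bounded {x. complex_of_real (max 0 (1 - real (Suc n) * infdist x K)) \<noteq> 0}"
  proof -
    obtain a r where r: "\<forall>k\<in>K. dist a k \<le> r"
      using assms by (auto simp: bounded_def)
    have "{x. complex_of_real (max 0 (1 - real (Suc n) * infdist x K)) \<noteq> 0} \<subseteq> cball a (r + 1)"
    proof safe
      fix x assume "complex_of_real (max 0 (1 - real (Suc n) * infdist x K)) \<noteq> 0"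
      then have "real (Suc n) * infdist x K < 1"
        by (auto simp: max_def split: if_splits)
      moreover have "1 * infdist x K \<le> real (Suc n) * infdist x K"
        by (intro mult_right_mono infdist_nonneg) auto
      ultimately have "infdist x K < 1" by simp
      then obtain k where "k \<in> K" "dist x k < 1"
        using assms by (auto simp: infdist_def cINF_less_iff split: if_splits)
      then show "x \<in> cball a (r + 1)"
        using r dist_triangle[of a x k] by (force simp: dist_commute)
    qed
    then show ?thesis
      by (rule bounded_subset[OF bounded_cball])
  qed
  ultimately show ?thesis
    by (auto simp: lipschitz_bs_def)
qed

lemma lipschitz_bs_dense_compact:
  fixes K :: "'a::polish_space set"
  assumes "prob_space M" and M: "sets M = sets borel" and K: "compact K" and e: "0 < e"
  shows "\<exists>h\<in>lipschitz_bs. L2_norm M (\<lambda>x. of_real (indicator K x) - h x) < e"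
proof -
  interpret prob_space M by fact
  \<comment> \<open>The empty set is separated because \<open>infdist x {} = 0\<close> would turn
    every tent into the constant 1.\<close>
  show ?thesis
  proof (cases "K = {}")
    case True
    moreover have "(\<lambda>_. 0) \<in> lipschitz_bs"
      by (auto simp: lipschitz_bs_def lipschitz_on_def intro!: exI[of _ 0])
    ultimately show ?thesis
      using e by (intro bexI[of _ "\<lambda>_. 0"]) auto
  next
    case False
    let ?h = "\<lambda>n x. complex_of_real (max 0 (1 - real (Suc n) * infdist x K))"
    have closed: "closed K" using K by (rule compact_imp_closed)
    have h: "?h n \<in> lipschitz_bs" for n
      using lipschitz_bs_bump[OF compact_imp_bounded[OF K] False] .
    have "(\<lambda>n. L2_norm M (\<lambda>x. of_real (indicator K x) - ?h n x)) \<longlonglongrightarrow> 0"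
    proof (rule L2_dominated_convergence[OF L2_const[of 1]])
      show "(\<lambda>x. complex_of_real (indicator K x)) \<in> borel_measurable M"
        using closed M by (intro measurable_compose[OF borel_measurable_indicator borel_measurable_of_real])
          (simp add: borel_closed)
      show "?h n \<in> borel_measurable M" for n
        using lipschitz_bs_measurable[OF h] M by (simp cong: measurable_cong_sets)
      show "cmod (of_real (indicator K x)) \<le> cmod 1" for x
        by (simp add: indicator_def)
      show "cmod (?h n x) \<le> cmod 1" for n x
        by (simp add: infdist_nonneg del: of_nat_Suc)
      show "(\<lambda>n. ?h n x) \<longlonglongrightarrow> of_real (indicator K x)" for x
      proof (cases "x \<in> K")
        case True
        then show ?thesis by simp
      next
        \<comment> \<open>Off the closed set \<open>K\<close> the distance is positive, so the tents
          vanish there from some index on.\<close>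
        case x: False
        then have pos: "0 < infdist x K"
          using closed False in_closed_iff_infdist_zero infdist_nonneg by (metis order_le_less)
        obtain N where N: "1 < real N * infdist x K"
          using reals_Archimedean3[OF pos] by blast
        have "?h n x = 0" if "N \<le> n" for n
        proof -
          have "real N * infdist x K \<le> real (Suc n) * infdist x K"
            using that pos by (intro mult_right_mono) auto
          then show ?thesis using N by simp
        qed
        then have "\<forall>\<^sub>F n in sequentially. ?h n x = 0"
          using eventually_sequentially by blast
        then show ?thesis
          using x by (auto intro: tendsto_eventually)
      qed
    qed
    then have "\<forall>\<^sub>F n in sequentially. L2_norm M (\<lambda>x. of_real (indicator K x) - ?h n x) < e"
      using e by (auto dest: order_tendstoD)
    then obtain n where "L2_norm M (\<lambda>x. of_real (indicator K x) - ?h n x) < e"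
      by (auto simp: eventually_sequentially)
    then show ?thesis
      using h[of n] by (rule bexI)
  qed
qed

lemma (in prob_space) L2_norm_indicator_diff:
  assumes "A \<in> sets M" "K \<in> sets M" "K \<subseteq> A"
  shows "L2_norm M (\<lambda>x. of_real (indicator A x) - of_real (indicator K x)) = sqrt (prob A - prob K)"
proof -
  have eq: "(cmod (of_real (indicator A x) - of_real (indicator K x)))\<^sup>2 = indicator (A - K) x" for x
    using assms by (auto simp: indicator_def)
  show ?thesis
    unfolding L2_norm_def eq using assms by (simp add: finite_measure_Diff)
qed

text \<open>The approximable functions \<open>D\<close> are closed under sums, multiples and limits
  in norm. They contain indicators of compact sets, hence of Borel sets by inner regularity on a
  Polish space, hence nonnegative functions by monotone approximation, hence real and imaginary
  parts.\<close>

lemma lipschitz_bs_dense: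
  fixes f :: "'a::polish_space \<Rightarrow> complex"
  assumes "prob_space M" and M: "sets M = sets borel" and f: "f \<in> L2 M" and e: "0 < e"
  shows "\<exists>h\<in>lipschitz_bs. L2_norm M (\<lambda>x. f x - h x) < e"
proof -
  interpret prob_space M by fact
  define D where "D f \<longleftrightarrow> (\<forall>e>0. \<exists>h\<in>lipschitz_bs. L2_norm M (\<lambda>x. f x - h x) < e)" for f
  note lip_L2 = lipschitz_bs_L2[OF prob_space_axioms M]
  have D_limit: "D f" if f: "f \<in> L2 M" and g: "\<And>e. e > 0 \<Longrightarrow> \<exists>g\<in>L2 M. D g \<and> L2_norm M (\<lambda>x. f x - g x) < e" for f
    unfolding D_def
  proof (intro allI impI)
    fix e :: real assume "e > 0"
    then have e2: "e / 2 > 0" by simp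
    obtain g where g: "g \<in> L2 M" "D g" "L2_norm M (\<lambda>x. f x - g x) < e / 2"
      using g[OF e2] by blast
    obtain h where h: "h \<in> lipschitz_bs" "L2_norm M (\<lambda>x. g x - h x) < e / 2"
      using g(2) e2 unfolding D_def by blast
    have "L2_norm M (\<lambda>x. (f x - g x) + (g x - h x)) < e"
      using L2_norm_triangle[OF L2_diff[OF f g(1)] L2_diff[OF g(1) lip_L2[OF h(1)]]] g h by simp
    then show "\<exists>h\<in>lipschitz_bs. L2_norm M (\<lambda>x. f x - h x) < e"
      using h by auto
  qed
  have D_add: "D (\<lambda>x. f x + g x)" if f: "f \<in> L2 M" "D f" and g: "g \<in> L2 M" "D g" for f g
    unfolding D_def
  proof (intro allI impI)
    fix e :: real assume "e > 0"
    then have e2: "e / 2 > 0" by simp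
    obtain h where h: "h \<in> lipschitz_bs" "L2_norm M (\<lambda>x. f x - h x) < e / 2"
      using f e2 unfolding D_def by blast
    obtain k where k: "k \<in> lipschitz_bs" "L2_norm M (\<lambda>x. g x - k x) < e / 2"
      using g e2 unfolding D_def by blast
    have "L2_norm M (\<lambda>x. (f x - h x) + (g x - k x)) < e"
      using L2_norm_triangle[OF L2_diff[OF f(1) lip_L2[OF h(1)]] L2_diff[OF g(1) lip_L2[OF k(1)]]] h k
      by simp
    then have "L2_norm M (\<lambda>x. (f x + g x) - (h x + k x)) < e"
      by (simp add: algebra_simps)
    then show "\<exists>h\<in>lipschitz_bs. L2_norm M (\<lambda>x. f x + g x - h x) < e"
      using lipschitz_bs_add[OF h(1) k(1)] by (rule bexI)
  qed
  have D_scale: "D (\<lambda>x. c * f x)" if f: "D f" for f c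
    unfolding D_def
  proof (intro allI impI)
    fix e :: real assume "e > 0"
    then have e2: "e / (cmod c + 1) > 0" by (simp add: add_nonneg_pos)
    obtain h where h: "h \<in> lipschitz_bs" "L2_norm M (\<lambda>x. f x - h x) < e / (cmod c + 1)"
      using f e2 unfolding D_def by blast
    have "L2_norm M (\<lambda>x. c * (f x - h x)) \<le> cmod c * (e / (cmod c + 1))"
      unfolding L2_norm_scale using h by (intro mult_left_mono) auto
    also have "\<dots> < (cmod c + 1) * (e / (cmod c + 1))"
      using e2 by (intro mult_strict_right_mono) auto
    also have "\<dots> = e"
      by (simp add: add_nonneg_pos order_less_imp_not_eq2)
    finally have "L2_norm M (\<lambda>x. c * f x - c * h x) < e"
      by (simp add: algebra_simps)
    then show "\<exists>h\<in>lipschitz_bs. L2_norm M (\<lambda>x. c * f x - h x) < e"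
      using lipschitz_bs_scale[OF h(1), of c] by (rule bexI)
  qed
  have ind_L2: "(\<lambda>x. complex_of_real (indicator A x)) \<in> L2 M" if "A \<in> sets M" for A
    using that by (intro L2_bounded[where B = 1]) (auto simp: indicator_def)
  have D_indicator: "D (\<lambda>x. complex_of_real (indicator A x))" if A: "A \<in> sets M" for A
  proof (rule D_limit[OF ind_L2[OF A]])
    fix e :: real assume e: "e > 0"
    have sup: "ennreal (prob A) = (SUP K \<in> {K. K \<subseteq> A \<and> compact K}. emeasure M K)"
      using inner_regular[OF M _ A[unfolded M]] by (simp add: emeasure_eq_measure)
    \<comment> \<open>The norm of the difference of the indicators is the square root of the lost
      mass, so a loss of at most \<open>e\<^sup>2 / 2\<close> keeps it below
      \<open>e\<close>.\<close>
    obtain K where K: "K \<subseteq> A" "compact K" "prob A - e\<^sup>2 / 2 \<le> prob K"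
    proof (rule ccontr)
      assume "\<not> thesis"
      with that have neg: "prob K < prob A - e\<^sup>2 / 2" if "K \<subseteq> A" "compact K" for K
        using that not_le by blast
      have "ennreal (prob A) \<le> ennreal (prob A - e\<^sup>2 / 2)"
        unfolding sup
      proof (rule SUP_least)
        fix K assume "K \<in> {K. K \<subseteq> A \<and> compact K}"
        then have "prob K \<le> prob A - e\<^sup>2 / 2"
          using neg[of K] by simp
        then show "emeasure M K \<le> ennreal (prob A - e\<^sup>2 / 2)"
          unfolding emeasure_eq_measure by (rule ennreal_leI)
      qed
      \<comment> \<open>\<open>ennreal\<close> sends negative numbers to 0, so the bound on
        \<open>prob A\<close> is contradictory only once its right-hand side is positive; the
        compact set \<open>{}\<close> shows that it is.\<close>
      moreover have "0 < prob A - e\<^sup>2 / 2"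
        using neg[of "{}"] by simp
      ultimately show False
        using e by simp
    qed
    have KM: "K \<in> sets M"
      using K(2) M by (simp add: compact_imp_closed borel_closed)
    have "prob A - prob K < e\<^sup>2"
      using K(3) e by (smt (verit) field_sum_of_halves zero_less_power)
    then have "sqrt (prob A - prob K) < e"
      using e by (simp add: real_less_lsqrt finite_measure_mono[OF K(1) A])
    then have "L2_norm M (\<lambda>x. of_real (indicator A x) - of_real (indicator K x)) < e"
      using L2_norm_indicator_diff[OF A KM K(1)] by simp
    moreover have "D (\<lambda>x. complex_of_real (indicator K x))"
      unfolding D_def using lipschitz_bs_dense_compact[OF prob_space_axioms M K(2)] by blast
    ultimately show "\<exists>g\<in>L2 M. D g \<and> L2_norm M (\<lambda>x. of_real (indicator A x) - g x) < e"
      using ind_L2[OF KM] by blast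
  qed
  \<comment> \<open>Square integrability is kept as a premise inside the induction. It passes from a
    sum or a monotone limit to the constituents, since these are nonnegative and dominated by the
    whole.\<close>
  have D_nonneg: "(\<lambda>x. complex_of_real (u x)) \<in> L2 M \<longrightarrow> D (\<lambda>x. complex_of_real (u x))"
    if "u \<in> borel_measurable M" "\<And>x. 0 \<le> u x" for u
    using that
  proof (induction u rule: borel_measurable_induct_real)
    case (set A)
    then show ?case using D_indicator by simp
  next
    case (mult u c)
    show ?case
    \<comment> \<open>For \<open>c = 0\<close> the square integrability of the multiple says nothing
      about \<open>u\<close>; the zero function is instead the indicator of the empty set.\<close>
    proof (cases "c = 0")
      case True
      then show ?thesis using D_indicator[of "{}"] by simp
    next
      case False
      show ?thesis
      proof
        assume "(\<lambda>x. complex_of_real (c * u x)) \<in> L2 M"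
        from L2_scale[OF this, of "1 / of_real c"] have "(\<lambda>x. complex_of_real (u x)) \<in> L2 M"
          using False by simp
        with mult D_scale[of "\<lambda>x. complex_of_real (u x)" "of_real c"]
        show "D (\<lambda>x. complex_of_real (c * u x))" by simp
      qed
    qed
  next
    case (add u v)
    show ?case
    proof
      assume uv: "(\<lambda>x. complex_of_real (v x + u x)) \<in> L2 M"
      have nonneg: "0 \<le> u x" "0 \<le> v x" for x
        using add by blast+
      have u: "(\<lambda>x. complex_of_real (u x)) \<in> L2 M"
      proof (rule L2_bound[OF uv])
        show "AE x in M. cmod (of_real (u x)) \<le> cmod (of_real (v x + u x))"
          by (intro AE_I2) (simp add: nonneg del: of_real_add)
      qed (use add in measurable)
      have v: "(\<lambda>x. complex_of_real (v x)) \<in> L2 M"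
      proof (rule L2_bound[OF uv])
        show "AE x in M. cmod (of_real (v x)) \<le> cmod (of_real (v x + u x))"
          by (intro AE_I2) (simp add: nonneg del: of_real_add)
      qed (use add in measurable)
      with add u v D_add[of "\<lambda>x. of_real (v x)" "\<lambda>x. of_real (u x)"]
      show "D (\<lambda>x. complex_of_real (v x + u x))" by simp
    qed
  next
    case (seq U)
    show ?case
    proof
      assume u: "(\<lambda>x. complex_of_real (u x)) \<in> L2 M"
      have nonneg: "0 \<le> U i x" for i x
        using seq by blast
      have le: "U i x \<le> u x" if "x \<in> space M" for i x
        using seq that by (intro incseq_le) (auto simp: incseq_def le_fun_def)
      have U: "(\<lambda>x. complex_of_real (U i x)) \<in> L2 M" for i
      proof (rule L2_bound[OF u])
        show "AE x in M. cmod (of_real (U i x)) \<le> cmod (of_real (u x))"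
        proof (rule AE_I2)
          fix x assume "x \<in> space M"
          then show "cmod (of_real (U i x)) \<le> cmod (of_real (u x))"
            using le[of x i] nonneg[of i x] by simp
        qed
      qed (use seq in measurable)
      have space: "space M = UNIV"
        using sets_eq_imp_space_eq[OF M] by simp
      have lim: "(\<lambda>i. L2_norm M (\<lambda>x. complex_of_real (u x) - of_real (U i x))) \<longlonglongrightarrow> 0"
      proof (rule L2_dominated_convergence[OF u])
        show "cmod (of_real (U i x)) \<le> cmod (of_real (u x))" for i x
          using le[of x i] nonneg[of i x] by (simp add: space)
        show "(\<lambda>i. complex_of_real (U i x)) \<longlonglongrightarrow> of_real (u x)" if "x \<in> space M" for x
          using seq that by (intro tendsto_of_real)
      qed (use u U in auto)
      show "D (\<lambda>x. complex_of_real (u x))"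
      proof (rule D_limit[OF u])
        fix e :: real assume "e > 0"
        with lim have "\<forall>\<^sub>F i in sequentially. L2_norm M (\<lambda>x. complex_of_real (u x) - of_real (U i x)) < e"
          by (auto dest: order_tendstoD)
        then obtain i where "L2_norm M (\<lambda>x. complex_of_real (u x) - of_real (U i x)) < e"
          by (auto simp: eventually_sequentially)
        then show "\<exists>g\<in>L2 M. D g \<and> L2_norm M (\<lambda>x. complex_of_real (u x) - g x) < e"
          using U seq by blast
      qed
    qed
  qed
  have D_real: "D (\<lambda>x. complex_of_real (u x))" if u: "(\<lambda>x. complex_of_real (u x)) \<in> L2 M"
    and [measurable]: "u \<in> borel_measurable M" for u
  proof -
    have pos: "(\<lambda>x. complex_of_real (max 0 (u x))) \<in> L2 M"
      by (rule L2_bound[OF u]) auto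
    have neg: "(\<lambda>x. complex_of_real (max 0 (- u x))) \<in> L2 M"
      by (rule L2_bound[OF u]) auto
    have "D (\<lambda>x. complex_of_real (max 0 (u x)))"
      using D_nonneg[of "\<lambda>x. max 0 (u x)"] pos by simp
    moreover have "D (\<lambda>x. complex_of_real (max 0 (- u x)))"
      using D_nonneg[of "\<lambda>x. max 0 (- u x)"] neg by simp
    ultimately have "D (\<lambda>x. complex_of_real (max 0 (u x)) + (-1) * complex_of_real (max 0 (- u x)))"
      using pos neg by (intro D_add D_scale L2_scale)
    moreover have "complex_of_real (max 0 (u x)) + (-1) * complex_of_real (max 0 (- u x)) = u x" for x
      by (auto simp: max_def)
    ultimately show ?thesis by simp
  qed
  note [measurable] = f
  have Re: "(\<lambda>x. complex_of_real (Re (f x))) \<in> L2 M"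
    by (rule L2_bound[OF f]) (auto simp: abs_Re_le_cmod)
  have Im: "(\<lambda>x. complex_of_real (Im (f x))) \<in> L2 M"
    by (rule L2_bound[OF f]) (auto simp: abs_Im_le_cmod)
  have "D (\<lambda>x. complex_of_real (Re (f x)) + \<i> * complex_of_real (Im (f x)))"
    using Re Im by (intro D_add D_scale D_real L2_scale) auto
  then have "D f"
    by (simp flip: complex_eq)
  then show ?thesis
    using e by (simp add: D_def)
qed

section \<open>Markov kernels as operators\<close>

lemma
  assumes "markov_kernel P"
  shows markov_kernel_prob_algebra: "P \<in> borel \<rightarrow>\<^sub>M prob_algebra borel"
    and markov_kernel_subprob_algebra: "P \<in> borel \<rightarrow>\<^sub>M subprob_algebra borel"
    and prob_space_markov_kernel: "prob_space (P x)"
    and sets_markov_kernel: "sets (P x) = sets borel"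
    and space_markov_kernel: "space (P x) = UNIV"
proof -
  show P: "P \<in> borel \<rightarrow>\<^sub>M prob_algebra borel"
    using assms by (simp add: markov_kernel_def)
  then show "P \<in> borel \<rightarrow>\<^sub>M subprob_algebra borel"
    by (rule measurable_prob_algebraD)
  have "P x \<in> space (prob_algebra borel)"
    using P by (rule measurable_space) simp
  then show "prob_space (P x)" "sets (P x) = sets borel"
    by (auto simp: space_prob_algebra)
  from sets_eq_imp_space_eq[OF this(2)] show "space (P x) = UNIV" by simp
qed

lemma
  assumes "stationary \<pi> P"
  shows stationary_prob_space: "prob_space \<pi>" and stationary_sets: "sets \<pi> = sets borel"
    and stationary_bind: "\<pi> \<bind> P = \<pi>"
  using assms by (auto simp: stationary_def space_prob_algebra)

lemma kernel_op_measurable: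
  assumes "markov_kernel P" "f \<in> borel_measurable borel"
  shows "kernel_op P f \<in> borel_measurable borel"
  unfolding kernel_op_def
  by (rule measurable_compose[OF markov_kernel_subprob_algebra integral_measurable_subprob_algebra])
     (use assms in auto)

text \<open>Jensen's inequality for the squared modulus. Outside \<open>L2\<close> the right-hand
  side is infinite, so measurability is enough.\<close>

lemma (in prob_space) integral_power2_le:
  assumes "f \<in> borel_measurable M"
  shows "ennreal ((cmod (\<integral>x. f x \<partial>M))\<^sup>2) \<le> (\<integral>\<^sup>+x. ennreal ((cmod (f x))\<^sup>2) \<partial>M)"
proof (cases "f \<in> L2 M")
  case True
  then have "(cmod (\<integral>x. f x \<partial>M))\<^sup>2 \<le> (L2_norm M f)\<^sup>2"
    by (intro power_mono integral_le_L2_norm) auto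
  then show ?thesis
    unfolding nn_integral_L2_norm[OF True] by (rule ennreal_leI)
next
  case False
  then have "(\<integral>\<^sup>+x. ennreal ((cmod (f x))\<^sup>2) \<partial>M) = \<infinity>"
    using assms by (simp add: L2_iff_nn_integral not_less top_unique)
  then show ?thesis by simp
qed

lemma nn_integral_stationary:
  assumes "markov_kernel P" "stationary \<pi> P" "f \<in> borel_measurable borel"
  shows "(\<integral>\<^sup>+x. \<integral>\<^sup>+y. f y \<partial>P x \<partial>\<pi>) = (\<integral>\<^sup>+x. f x \<partial>\<pi>)"
proof -
  have "P \<in> \<pi> \<rightarrow>\<^sub>M subprob_algebra borel"
    using markov_kernel_subprob_algebra[OF assms(1)] stationary_sets[OF assms(2)]
    by (simp cong: measurable_cong_sets)
  from nn_integral_bind[OF assms(3) this] show ?thesis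
    by (simp add: stationary_bind[OF assms(2)])
qed

text \<open>Jensen's inequality under each \<open>P x\<close>, integrated against the invariant
  measure, shows that the operator is a contraction. The same iterated integral is finite, so
  \<open>f\<close> is square integrable under almost every \<open>P x\<close>.\<close>

lemma
  assumes P: "markov_kernel P" "stationary \<pi> P" and f: "f \<in> L2 \<pi>"
  shows kernel_op_L2: "kernel_op P f \<in> L2 \<pi>"
    and kernel_op_norm: "L2_norm \<pi> (kernel_op P f) \<le> L2_norm \<pi> f"
    and AE_L2_kernel: "AE x in \<pi>. f \<in> L2 (P x)"
proof -
  have sets: "sets \<pi> = sets borel"
    using P(2) by (rule stationary_sets)
  have fm [measurable]: "f \<in> borel_measurable borel"
    using f sets by (auto simp: L2_def cong: measurable_cong_sets)
  have fP: "f \<in> borel_measurable (P x)" for x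
    using fm sets_markov_kernel[OF P(1)] by (simp cong: measurable_cong_sets)
  have eq: "(\<integral>\<^sup>+x. \<integral>\<^sup>+y. ennreal ((cmod (f y))\<^sup>2) \<partial>P x \<partial>\<pi>) = ennreal ((L2_norm \<pi> f)\<^sup>2)"
    using nn_integral_L2_norm[OF f] by (subst nn_integral_stationary[OF P]) auto
  have "(\<lambda>x. \<integral>\<^sup>+y. ennreal ((cmod (f y))\<^sup>2) \<partial>P x) \<in> borel_measurable borel"
    by (rule measurable_compose[OF markov_kernel_subprob_algebra[OF P(1)] nn_integral_measurable_subprob_algebra])
       measurable
  then have "AE x in \<pi>. (\<integral>\<^sup>+y. ennreal ((cmod (f y))\<^sup>2) \<partial>P x) \<noteq> \<infinity>"
    using eq sets by (intro nn_integral_PInf_AE) (auto cong: measurable_cong_sets)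
  then show "AE x in \<pi>. f \<in> L2 (P x)"
    by eventually_elim (simp add: L2_iff_nn_integral fP less_top)
  have le: "(\<integral>\<^sup>+x. ennreal ((cmod (kernel_op P f x))\<^sup>2) \<partial>\<pi>) \<le> ennreal ((L2_norm \<pi> f)\<^sup>2)"
    unfolding eq[symmetric] kernel_op_def
    by (intro nn_integral_mono prob_space.integral_power2_le prob_space_markov_kernel[OF P(1)] fP)
  have m: "kernel_op P f \<in> borel_measurable \<pi>"
    using kernel_op_measurable[OF P(1) fm] sets by (simp cong: measurable_cong_sets)
  show K: "kernel_op P f \<in> L2 \<pi>"
    using le_less_trans[OF le] m by (simp add: L2_iff_nn_integral)
  have "(L2_norm \<pi> (kernel_op P f))\<^sup>2 \<le> (L2_norm \<pi> f)\<^sup>2"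
    using le unfolding nn_integral_L2_norm[OF K] by simp
  then show "L2_norm \<pi> (kernel_op P f) \<le> L2_norm \<pi> f"
    by (rule power2_le_imp_le) simp
qed

lemma bounded_op_kernel_op:
  assumes P: "markov_kernel P" "stationary \<pi> P"
  shows "bounded_op \<pi> (kernel_op P)"
proof (rule bounded_opI[where C = 1])
  have integrable: "integrable (P x) f" if "f \<in> L2 (P x)" for f x
    using prob_space.L2_integrable[OF prob_space_markov_kernel[OF P(1)] that] .
  \<comment> \<open>At points where \<open>f\<close> or \<open>g\<close> is not integrable under
    \<open>P x\<close> the Bochner integral is 0 by convention and additivity may fail; these points
    form a null set.\<close>
  show "AE x in \<pi>. kernel_op P (\<lambda>x. f x + g x) x = kernel_op P f x + kernel_op P g x"
    if f: "f \<in> L2 \<pi>" and g: "g \<in> L2 \<pi>" for f g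
    using AE_L2_kernel[OF P f] AE_L2_kernel[OF P g]
    by eventually_elim (simp add: kernel_op_def integrable)
qed (use kernel_op_L2[OF P] kernel_op_norm[OF P] in \<open>auto simp: kernel_op_def\<close>)

text \<open>On this class kernel operators are given by genuine integrals at every point, with no
  exceptional null set, and unlike bounded support the class is preserved by them. Iterates,
  adjoints and Lipschitz bounds are therefore handled here.\<close>

definition bounded_borel :: "('a::topological_space \<Rightarrow> complex) set" where
  "bounded_borel = {f \<in> borel_measurable borel. \<exists>B. \<forall>x. cmod (f x) \<le> B}"

lemma bounded_borel_measurable [measurable_dest]: "f \<in> bounded_borel \<Longrightarrow> f \<in> borel_measurable borel"
  by (simp add: bounded_borel_def)

lemma lipschitz_bs_bounded_borel: "f \<in> lipschitz_bs \<Longrightarrow> f \<in> bounded_borel"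
  using lipschitz_bs_bounded[of f] lipschitz_bs_measurable[of f] by (auto simp: bounded_borel_def)

lemma bounded_borel_L2:
  assumes "prob_space M" "sets M = sets borel" "f \<in> bounded_borel"
  shows "f \<in> L2 M"
proof -
  interpret prob_space M by fact
  obtain B where "\<And>x. cmod (f x) \<le> B"
    using assms(3) by (auto simp: bounded_borel_def)
  then show ?thesis
    using assms by (intro L2_bounded) (auto simp: bounded_borel_def cong: measurable_cong_sets)
qed

lemma kernel_op_bounded_borel:
  assumes P: "markov_kernel P" and f: "f \<in> bounded_borel"
  shows "kernel_op P f \<in> bounded_borel"
proof -
  obtain B where B: "\<And>x. cmod (f x) \<le> B"
    using f by (auto simp: bounded_borel_def)
  have "cmod (kernel_op P f x) \<le> B" for x
  proof -
    interpret prob_space "P x" using P by (rule prob_space_markov_kernel)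
    have fm: "f \<in> borel_measurable (P x)"
      using bounded_borel_measurable[OF f] sets_markov_kernel[OF P] by (simp cong: measurable_cong_sets)
    show ?thesis
      unfolding kernel_op_def using integral_le_L2_norm[OF L2_bounded(1)[OF fm B]] L2_bounded(2)[OF fm B]
      by linarith
  qed
  then show ?thesis
    using kernel_op_measurable[OF P bounded_borel_measurable[OF f]] by (auto simp: bounded_borel_def)
qed

text \<open>Real and imaginary parts reduce this to the real-valued \<open>integral_bind\<close>;
  boundedness supplies all integrability conditions.\<close>

lemma integral_bind_bounded:
  fixes f :: "'b \<Rightarrow> complex"
  assumes "prob_space M" and N: "N \<in> M \<rightarrow>\<^sub>M prob_algebra K"
    and f [measurable]: "f \<in> borel_measurable K" and B: "\<And>x. cmod (f x) \<le> B"
  shows "(\<integral>x. f x \<partial>(M \<bind> N)) = (\<integral>x. (\<integral>y. f y \<partial>N x) \<partial>M)"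
proof -
  interpret prob_space M by fact
  have M: "M \<in> space (prob_algebra M)"
    by (simp add: space_prob_algebra prob_space_axioms)
  have Nx: "prob_space (N x)" "sets (N x) = sets K" if "x \<in> space M" for x
    using measurable_space[OF N that] by (auto simp: space_prob_algebra)
  note real_bind = integral_bind[OF _ _ measurable_prob_algebraD[OF N] finite_measure_axioms, where B = B and B' = 1]
  have AE: "AE x in M. emeasure (N x) (space (N x)) \<le> ennreal 1"
    using Nx by (intro AE_I2) (simp add: prob_space.emeasure_space_1)
  have Re: "(\<integral>x. Re (f x) \<partial>(M \<bind> N)) = (\<integral>x. (\<integral>y. Re (f y) \<partial>N x) \<partial>M)"
    by (rule real_bind[OF _ _ AE]) (auto simp: order_trans[OF abs_Re_le_cmod B])
  have Im: "(\<integral>x. Im (f x) \<partial>(M \<bind> N)) = (\<integral>x. (\<integral>y. Im (f y) \<partial>N x) \<partial>M)"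
    by (rule real_bind[OF _ _ AE]) (auto simp: order_trans[OF abs_Im_le_cmod B])
  have int: "integrable (M \<bind> N) f"
    using prob_space_bind'[OF M, of N] sets_bind'[OF M, of N] N B f
    by (intro finite_measure.integrable_const_bound[where B = B] prob_space.finite_measure)
       (auto cong: measurable_cong_sets)
  have int_N: "integrable (N x) f" if "x \<in> space M" for x
    using Nx[OF that] B f
    by (intro finite_measure.integrable_const_bound[where B = B] prob_space.finite_measure)
       (auto cong: measurable_cong_sets)
  have meas: "(\<lambda>x. \<integral>y. f y \<partial>N x) \<in> borel_measurable M"
    by (rule measurable_compose[OF measurable_prob_algebraD[OF N] integral_measurable_subprob_algebra[OF f]])
  have int_int: "integrable M (\<lambda>x. \<integral>y. f y \<partial>N x)"
  proof (rule integrable_const_bound[OF AE_I2 meas])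
    fix x assume x: "x \<in> space M"
    interpret N: prob_space "N x" using Nx(1)[OF x] .
    have "f \<in> borel_measurable (N x)"
      using f Nx(2)[OF x] by (simp cong: measurable_cong_sets)
    from N.integral_le_L2_norm[OF N.L2_bounded(1)[OF this B]] N.L2_bounded(2)[OF this B]
    show "cmod (\<integral>y. f y \<partial>N x) \<le> B" by linarith
  qed
  show ?thesis
  proof (rule complex_eqI)
    have "Re (\<integral>x. f x \<partial>(M \<bind> N)) = (\<integral>x. (\<integral>y. Re (f y) \<partial>N x) \<partial>M)"
      using Re integral_Re[OF int] by simp
    also have "\<dots> = (\<integral>x. Re (\<integral>y. f y \<partial>N x) \<partial>M)"
      by (intro Bochner_Integration.integral_cong) (auto simp: int_N integral_Re)
    also have "\<dots> = Re (\<integral>x. (\<integral>y. f y \<partial>N x) \<partial>M)"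
      by (rule integral_Re[OF int_int])
    finally show "Re (\<integral>x. f x \<partial>(M \<bind> N)) = Re (\<integral>x. (\<integral>y. f y \<partial>N x) \<partial>M)" .
    have "Im (\<integral>x. f x \<partial>(M \<bind> N)) = (\<integral>x. (\<integral>y. Im (f y) \<partial>N x) \<partial>M)"
      using Im integral_Im[OF int] by simp
    also have "\<dots> = (\<integral>x. Im (\<integral>y. f y \<partial>N x) \<partial>M)"
      by (intro Bochner_Integration.integral_cong) (auto simp: int_N integral_Im)
    also have "\<dots> = Im (\<integral>x. (\<integral>y. f y \<partial>N x) \<partial>M)"
      by (rule integral_Im[OF int_int])
    finally show "Im (\<integral>x. f x \<partial>(M \<bind> N)) = Im (\<integral>x. (\<integral>y. f y \<partial>N x) \<partial>M)" .
  qed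
qed

section \<open>Kernel operators preserve the mean\<close>

lemma measurable_kernel_cong:
  "sets \<pi> = sets borel \<Longrightarrow> K \<in> borel \<rightarrow>\<^sub>M N \<Longrightarrow> K \<in> \<pi> \<rightarrow>\<^sub>M N"
  by (simp cong: measurable_cong_sets)

lemma integral_kernel_op:
  assumes P: "markov_kernel P" "stationary \<pi> P" and f: "f \<in> bounded_borel"
  shows "(\<integral>x. kernel_op P f x \<partial>\<pi>) = (\<integral>x. f x \<partial>\<pi>)"
proof -
  obtain B where B: "\<And>x. cmod (f x) \<le> B"
    using f by (auto simp: bounded_borel_def)
  from integral_bind_bounded[OF stationary_prob_space[OF P(2)]
      measurable_kernel_cong[OF stationary_sets[OF P(2)] markov_kernel_prob_algebra[OF P(1)]]
      bounded_borel_measurable[OF f] B]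
  show ?thesis
    by (simp add: kernel_op_def stationary_bind[OF P(2)])
qed

text \<open>An identity on \<open>L2\<close> follows from the dense class
  \<open>lipschitz_bs\<close> by continuity. The quantity \<open>\<bar>C\<bar> + 1\<close> keeps the
  divisor positive whatever the value of \<open>C\<close>.\<close>

lemma L2_functional_eqI:
  fixes \<Phi> :: "('a::polish_space \<Rightarrow> complex) \<Rightarrow> complex"
  assumes "prob_space M" and M: "sets M = sets borel" and f: "f \<in> L2 M"
    and lip: "\<And>h. h \<in> lipschitz_bs \<Longrightarrow> \<Phi> h = 0"
    and cont: "\<And>h. h \<in> lipschitz_bs \<Longrightarrow> cmod (\<Phi> f - \<Phi> h) \<le> C * L2_norm M (\<lambda>x. f x - h x)"
  shows "\<Phi> f = 0"
proof -
  have "cmod (\<Phi> f) \<le> 0 + e" if e: "0 < e" for e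
  proof -
    have pos: "0 < e / (\<bar>C\<bar> + 1)"
      using e by (simp add: add_nonneg_pos)
    obtain h where h: "h \<in> lipschitz_bs" "L2_norm M (\<lambda>x. f x - h x) < e / (\<bar>C\<bar> + 1)"
      using lipschitz_bs_dense[OF assms(1-3) pos] by blast
    have "cmod (\<Phi> f) \<le> C * L2_norm M (\<lambda>x. f x - h x)"
      using cont[OF h(1)] lip[OF h(1)] by simp
    also have "\<dots> \<le> (\<bar>C\<bar> + 1) * L2_norm M (\<lambda>x. f x - h x)"
      by (intro mult_right_mono) auto
    also have "\<dots> \<le> (\<bar>C\<bar> + 1) * (e / (\<bar>C\<bar> + 1))"
      using h(2) by (intro mult_left_mono) auto
    finally show ?thesis
      by (simp add: add_nonneg_pos order_less_imp_not_eq2)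
  qed
  then have "cmod (\<Phi> f) \<le> 0"
    by (rule field_le_epsilon)
  then show ?thesis by simp
qed

lemma markov_op_kernel_op:
  assumes P: "markov_kernel P" "stationary \<pi> P"
  shows "markov_op \<pi> (kernel_op P)"
proof -
  interpret prob_space \<pi> using P(2) by (rule stationary_prob_space)
  note sets = stationary_sets[OF P(2)]
  note bounded = bounded_op_kernel_op[OF P]
  have "(\<integral>x. kernel_op P f x \<partial>\<pi>) = (\<integral>x. f x \<partial>\<pi>)" if f: "f \<in> L2 \<pi>" for f
  proof -
    \<comment> \<open>The defect of mean preservation is a difference of two functionals, each
      bounded by the \<open>L2\<close> norm; hence the constant 2 below.\<close>
    let ?\<Phi> = "\<lambda>f. (\<integral>x. kernel_op P f x \<partial>\<pi>) - (\<integral>x. f x \<partial>\<pi>)"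
    have "?\<Phi> f = 0"
    proof (rule L2_functional_eqI[where \<Phi> = ?\<Phi> and C = 2, OF prob_space_axioms sets f])
      show "?\<Phi> h = 0" if "h \<in> lipschitz_bs" for h
        using integral_kernel_op[OF P lipschitz_bs_bounded_borel[OF that]] by simp
      show "cmod (?\<Phi> f - ?\<Phi> h) \<le> 2 * L2_norm \<pi> (\<lambda>x. f x - h x)" if "h \<in> lipschitz_bs" for h
      proof -
        let ?d = "\<lambda>x. f x - h x"
        have h: "h \<in> L2 \<pi>"
          using lipschitz_bs_L2[OF prob_space_axioms sets that] .
        have d: "?d \<in> L2 \<pi>" using f h by (rule L2_diff)
        have "(\<integral>x. kernel_op P ?d x \<partial>\<pi>) = (\<integral>x. kernel_op P f x - kernel_op P h x \<partial>\<pi>)"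
          using bounded_op_diff[OF bounded f h] kernel_op_L2[OF P] f h d
          by (intro integral_cong_AE) auto
        also have "\<dots> = (\<integral>x. kernel_op P f x \<partial>\<pi>) - (\<integral>x. kernel_op P h x \<partial>\<pi>)"
          using f h by (intro Bochner_Integration.integral_diff L2_integrable kernel_op_L2[OF P])
        finally have "?\<Phi> f - ?\<Phi> h = (\<integral>x. kernel_op P ?d x \<partial>\<pi>) - (\<integral>x. ?d x \<partial>\<pi>)"
          using f h by (simp add: L2_integrable)
        then have "cmod (?\<Phi> f - ?\<Phi> h) \<le> cmod (\<integral>x. kernel_op P ?d x \<partial>\<pi>) + cmod (\<integral>x. ?d x \<partial>\<pi>)"
          by (simp only: norm_triangle_ineq4)
        also have "\<dots> \<le> 2 * L2_norm \<pi> ?d"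
          using integral_le_L2_norm[OF d] integral_le_L2_norm[OF kernel_op_L2[OF P d]] kernel_op_norm[OF P d]
          by simp
        finally show ?thesis .
      qed
    qed
    then show ?thesis by simp
  qed
  moreover have "kernel_op P (\<lambda>_. c) x = c" for c x
  proof -
    interpret Px: prob_space "P x" using P(1) by (rule prob_space_markov_kernel)
    show ?thesis by (simp add: kernel_op_def Px.prob_space)
  qed
  ultimately show ?thesis
    using bounded kernel_op_norm[OF P] by (simp add: markov_op_def)
qed

text \<open>The two sides are the joint law of a stationary step, disintegrated along either
  coordinate. The definition of \<open>time_reversal\<close> gives agreement on measurable
  rectangles, an intersection-stable generator of the product sigma-algebra.\<close>

lemma bind_pair_eq_of_time_reversal:
  assumes P: "markov_kernel P" "stationary \<pi> P" and Q: "time_reversal \<pi> P Q"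
  shows "\<pi> \<bind> (\<lambda>x. distr (Q x) (borel \<Otimes>\<^sub>M borel) (\<lambda>y. (x, y)))
       = \<pi> \<bind> (\<lambda>y. distr (P y) (borel \<Otimes>\<^sub>M borel) (\<lambda>x. (x, y)))" (is "?m1 = ?m2")
    and "(\<lambda>x. distr (Q x) (borel \<Otimes>\<^sub>M borel) (\<lambda>y. (x, y))) \<in> \<pi> \<rightarrow>\<^sub>M prob_algebra (borel \<Otimes>\<^sub>M borel)"
      (is ?meas1)
    and "(\<lambda>y. distr (P y) (borel \<Otimes>\<^sub>M borel) (\<lambda>x. (x, y))) \<in> \<pi> \<rightarrow>\<^sub>M prob_algebra (borel \<Otimes>\<^sub>M borel)"
      (is ?meas2)
proof -
  interpret prob_space \<pi> using P(2) by (rule stationary_prob_space)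
  note sets = stationary_sets[OF P(2)]
  have Q': "markov_kernel Q" using Q by (simp add: time_reversal_def)
  have \<pi>: "\<pi> \<in> space (prob_algebra \<pi>)"
    by (simp add: space_prob_algebra prob_space_axioms)
  show m1: ?meas1
    by (intro measurable_kernel_cong[OF sets] measurable_distr_prob_space2[OF markov_kernel_prob_algebra[OF Q']])
       simp
  show m2: ?meas2
    by (intro measurable_kernel_cong[OF sets] measurable_distr_prob_space2[OF markov_kernel_prob_algebra[OF P(1)]])
       simp
  show "?m1 = ?m2"
  proof (rule measure_eqI_generator_eq[OF Int_stable_pair_measure_generator[of borel borel]
        , where \<Omega> = UNIV and A = "\<lambda>_. UNIV"])
    show "sets ?m1 = sigma_sets UNIV {a \<times> b |a b. a \<in> sets borel \<and> b \<in> sets borel}"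
      unfolding sets_bind'[OF \<pi> m1] sets_pair_measure by simp
    show "sets ?m2 = sigma_sets UNIV {a \<times> b |a b. a \<in> sets borel \<and> b \<in> sets borel}"
      unfolding sets_bind'[OF \<pi> m2] sets_pair_measure by simp
    show "emeasure ?m1 UNIV \<noteq> \<infinity>"
      using prob_space.emeasure_le_1[OF prob_space_bind'[OF \<pi> m1], of UNIV] by (auto simp: top_unique)
    show "range (\<lambda>_. UNIV) \<subseteq> {a \<times> b |a b. a \<in> sets borel \<and> b \<in> sets borel}"
      by (auto intro!: exI[of _ UNIV])
    fix X :: "('a \<times> 'a) set" assume "X \<in> {a \<times> b |a b. a \<in> sets borel \<and> b \<in> sets borel}"
    then obtain A B :: "'a set" where X: "X = A \<times> B" and A [measurable]: "A \<in> sets borel" and B [measurable]: "B \<in> sets borel"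
      by auto
    have "emeasure ?m1 X = (\<integral>\<^sup>+x. emeasure (Q x) B * indicator A x \<partial>\<pi>)"
      unfolding X
    proof (subst emeasure_bind_prob_algebra[OF \<pi> m1], simp, intro nn_integral_cong)
      fix x
      have "(\<lambda>y. (x, y)) \<in> Q x \<rightarrow>\<^sub>M borel \<Otimes>\<^sub>M borel"
        using sets_markov_kernel[OF Q', of x] by (simp cong: measurable_cong_sets)
      then show "emeasure (distr (Q x) (borel \<Otimes>\<^sub>M borel) (\<lambda>y. (x, y))) (A \<times> B) = emeasure (Q x) B * indicator A x"
        by (subst emeasure_distr) (auto simp: space_markov_kernel[OF Q'] indicator_def vimage_def)
    qed
    moreover have "emeasure ?m2 X = (\<integral>\<^sup>+y. emeasure (P y) A * indicator B y \<partial>\<pi>)"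
      unfolding X
    proof (subst emeasure_bind_prob_algebra[OF \<pi> m2], simp, intro nn_integral_cong)
      fix y
      have "(\<lambda>x. (x, y)) \<in> P y \<rightarrow>\<^sub>M borel \<Otimes>\<^sub>M borel"
        using sets_markov_kernel[OF P(1), of y] by (simp cong: measurable_cong_sets)
      then show "emeasure (distr (P y) (borel \<Otimes>\<^sub>M borel) (\<lambda>x. (x, y))) (A \<times> B) = emeasure (P y) A * indicator B y"
        by (subst emeasure_distr) (auto simp: space_markov_kernel[OF P(1)] indicator_def vimage_def)
    qed
    ultimately show "emeasure ?m1 X = emeasure ?m2 X"
      using Q A B by (simp add: time_reversal_def)
  qed auto
qed

text \<open>Both inner products are the integral of \<open>f(y) cnj(g(x))\<close> against the common
  joint law, integrating over \<open>y\<close> first or over \<open>x\<close> first.\<close>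

lemma time_reversal_adjoint:
  assumes P: "markov_kernel P" "stationary \<pi> P" and Q: "time_reversal \<pi> P Q"
    and f: "f \<in> bounded_borel" and g: "g \<in> bounded_borel"
  shows "L2_inner \<pi> (kernel_op Q f) g = L2_inner \<pi> f (kernel_op P g)"
proof -
  have Q': "markov_kernel Q" using Q by (simp add: time_reversal_def)
  note prob = stationary_prob_space[OF P(2)]
  note [measurable] = bounded_borel_measurable[OF f] bounded_borel_measurable[OF g]
  obtain B C where B: "\<And>x. cmod (f x) \<le> B" and C: "\<And>x. cmod (g x) \<le> C"
    using f g by (auto simp: bounded_borel_def)
  let ?h = "\<lambda>z. f (snd z) * cnj (g (fst z))"
  have h: "?h \<in> borel_measurable (borel \<Otimes>\<^sub>M borel)"
    by measurable
  have hB: "cmod (?h z) \<le> B * C" for z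
    unfolding norm_mult complex_mod_cnj using B C order_trans[OF norm_ge_zero B] by (intro mult_mono) auto
  note pair = bind_pair_eq_of_time_reversal[OF P Q]
  have "L2_inner \<pi> (kernel_op Q f) g
      = (\<integral>x. (\<integral>z. ?h z \<partial>distr (Q x) (borel \<Otimes>\<^sub>M borel) (\<lambda>y. (x, y))) \<partial>\<pi>)"
    unfolding L2_inner_def kernel_op_def
  proof (rule Bochner_Integration.integral_cong[OF refl])
    fix x
    have "(\<lambda>y. (x, y)) \<in> Q x \<rightarrow>\<^sub>M borel \<Otimes>\<^sub>M borel"
      using sets_markov_kernel[OF Q', of x] by (simp cong: measurable_cong_sets)
    from integral_distr[OF this h]
    show "(\<integral>y. f y \<partial>Q x) * cnj (g x) = (\<integral>z. ?h z \<partial>distr (Q x) (borel \<Otimes>\<^sub>M borel) (\<lambda>y. (x, y)))"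
      by simp
  qed
  also have "\<dots> = (\<integral>z. ?h z \<partial>(\<pi> \<bind> (\<lambda>x. distr (Q x) (borel \<Otimes>\<^sub>M borel) (\<lambda>y. (x, y)))))"
    by (rule integral_bind_bounded[OF prob pair(2) h hB, symmetric])
  also have "\<dots> = (\<integral>y. (\<integral>z. ?h z \<partial>distr (P y) (borel \<Otimes>\<^sub>M borel) (\<lambda>x. (x, y))) \<partial>\<pi>)"
    unfolding pair(1) by (rule integral_bind_bounded[OF prob pair(3) h hB])
  also have "\<dots> = L2_inner \<pi> f (kernel_op P g)"
    unfolding L2_inner_def kernel_op_def
  proof (rule Bochner_Integration.integral_cong[OF refl])
    fix y
    have "(\<lambda>x. (x, y)) \<in> P y \<rightarrow>\<^sub>M borel \<Otimes>\<^sub>M borel"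
      using sets_markov_kernel[OF P(1), of y] by (simp cong: measurable_cong_sets)
    from integral_distr[OF this h]
    show "(\<integral>z. ?h z \<partial>distr (P y) (borel \<Otimes>\<^sub>M borel) (\<lambda>x. (x, y))) = f y * cnj (\<integral>x. g x \<partial>P y)"
      by simp
  qed
  finally show ?thesis .
qed

text \<open>Taking \<open>A = UNIV\<close> in the defining identity compares the second marginals;
  every \<open>P y\<close> has total mass one.\<close>

lemma time_reversal_stationary:
  assumes P: "markov_kernel P" "stationary \<pi> P" and Q: "time_reversal \<pi> P Q"
  shows "stationary \<pi> Q"
proof -
  interpret prob_space \<pi> using P(2) by (rule stationary_prob_space)
  note sets = stationary_sets[OF P(2)]
  have Q': "Q \<in> \<pi> \<rightarrow>\<^sub>M prob_algebra borel"
    using Q by (intro measurable_kernel_cong[OF sets] markov_kernel_prob_algebra) (simp add: time_reversal_def)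
  have \<pi>: "\<pi> \<in> space (prob_algebra \<pi>)"
    by (simp add: space_prob_algebra prob_space_axioms)
  have "\<pi> \<bind> Q = \<pi>"
  proof (rule measure_eqI)
    show "sets (\<pi> \<bind> Q) = sets \<pi>"
      using sets_bind'[OF \<pi> Q'] sets by simp
    fix B assume "B \<in> sets (\<pi> \<bind> Q)"
    then have B: "B \<in> sets borel"
      using sets_bind'[OF \<pi> Q'] by simp
    have one: "emeasure (P y) UNIV = 1" for y
      using prob_space.emeasure_space_1[OF prob_space_markov_kernel[OF P(1)], of y]
      by (simp add: space_markov_kernel[OF P(1)])
    have "emeasure (\<pi> \<bind> Q) B = (\<integral>\<^sup>+x\<in>UNIV. emeasure (Q x) B \<partial>\<pi>)"
      using emeasure_bind_prob_algebra[OF \<pi> Q' B] by simp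
    also have "\<dots> = (\<integral>\<^sup>+y\<in>B. emeasure (P y) UNIV \<partial>\<pi>)"
      using Q B sets.top[of "borel :: 'a measure"] unfolding time_reversal_def space_borel by blast
    also have "\<dots> = emeasure \<pi> B"
      using B sets by (simp add: one)
    finally show "emeasure (\<pi> \<bind> Q) B = emeasure \<pi> B" .
  qed
  then show ?thesis
    using P(2) by (simp add: stationary_def)
qed

section \<open>Powers of a kernel and of its operator\<close>

lemma markov_kernel_kernel_pow:
  assumes P: "markov_kernel P"
  shows "markov_kernel (kernel_pow P k)"
proof (induction k)
  case 0
  show ?case
    by (simp add: markov_kernel_def)
next
  case (Suc k)
  have "(\<lambda>x. kernel_pow P k x \<bind> P) \<in> borel \<rightarrow>\<^sub>M prob_algebra borel"
    using Suc P unfolding markov_kernel_def by (rule measurable_bind_prob_space)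
  then show ?case
    by (simp add: markov_kernel_def)
qed

lemma funpow_kernel_op_bounded_borel:
  "markov_kernel P \<Longrightarrow> f \<in> bounded_borel \<Longrightarrow> (kernel_op P ^^ k) f \<in> bounded_borel"
  by (induction k) (auto intro: kernel_op_bounded_borel)

text \<open>\<open>kernel_pow\<close> appends each new step at the end, so the last step is
  integrated out first. The induction therefore unfolds the power on the right and generalises over
  \<open>f\<close>.\<close>

lemma funpow_kernel_op:
  assumes P: "markov_kernel P" and f: "f \<in> bounded_borel"
  shows "(kernel_op P ^^ k) f = kernel_op (kernel_pow P k) f"
  using f
proof (induction k arbitrary: f)
  case 0
  show ?case
    using bounded_borel_measurable[OF 0] by (auto simp: kernel_op_def integral_return)
next
  case (Suc k)
  obtain B where B: "\<And>x. cmod (f x) \<le> B"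
    using Suc.prems by (auto simp: bounded_borel_def)
  note Pk = markov_kernel_kernel_pow[OF P, of k]
  have "kernel_op (kernel_pow P (Suc k)) f x = kernel_op (kernel_pow P k) (kernel_op P f) x" for x
    using integral_bind_bounded[OF prob_space_markov_kernel[OF Pk]
        measurable_kernel_cong[OF sets_markov_kernel[OF Pk] markov_kernel_prob_algebra[OF P]]
        bounded_borel_measurable[OF Suc.prems] B]
    by (simp add: kernel_op_def)
  then show ?case
    using Suc.IH[OF kernel_op_bounded_borel[OF P Suc.prems]] by (simp only: funpow_Suc_right o_apply)
qed

section \<open>Curvature and contraction\<close>

text \<open>Under any coupling the integral of \<open>f(X) - f(Y)\<close> is at most
  \<open>L\<close> times the expected distance. Couplings of cost below \<open>w + e\<close> are
  used, so that attainment of the infimum is not at issue.\<close>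

lemma integral_diff_le_W1:
  assumes f: "f \<in> bounded_borel" and L: "L-lipschitz_on UNIV f"
    and w: "W1 \<mu> \<nu> \<le> ennreal w" "0 \<le> w"
  shows "cmod ((\<integral>x. f x \<partial>\<mu>) - (\<integral>x. f x \<partial>\<nu>)) \<le> L * w"
proof -
  have L0: "0 \<le> L" using L by (rule lipschitz_on_nonneg)
  note [measurable] = bounded_borel_measurable[OF f]
  have le: "cmod ((\<integral>x. f x \<partial>\<mu>) - (\<integral>x. f x \<partial>\<nu>)) \<le> L * (w + e)" if e: "0 < e" for e
  proof -
    have "W1 \<mu> \<nu> < ennreal (w + e)"
      using w e by (intro le_less_trans[OF w(1)]) (simp add: ennreal_less_iff)
    then obtain m where m: "m \<in> couplings \<mu> \<nu>"
      and cost: "(\<integral>\<^sup>+z. ennreal (dist (fst z) (snd z)) \<partial>m) < ennreal (w + e)"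
      unfolding W1_def by (auto simp: INF_less_iff)
    have sets_m: "sets m = sets (borel \<Otimes>\<^sub>M borel)" and "prob_space m"
      and \<mu>: "\<mu> = distr m borel fst" and \<nu>: "\<nu> = distr m borel snd"
      using m by (auto simp: couplings_def space_prob_algebra)
    interpret prob_space m by fact
    have fst [measurable]: "fst \<in> m \<rightarrow>\<^sub>M borel" and snd [measurable]: "snd \<in> m \<rightarrow>\<^sub>M borel"
      using sets_m by (simp_all cong: measurable_cong_sets)
    obtain B where B: "\<And>x. cmod (f x) \<le> B"
      using f by (auto simp: bounded_borel_def)
    have int: "integrable m (\<lambda>z. f (fst z))" "integrable m (\<lambda>z. f (snd z))"
      by (auto intro!: integrable_const_bound[where B = B] B)
    have "(\<integral>x. f x \<partial>\<mu>) - (\<integral>x. f x \<partial>\<nu>) = (\<integral>z. f (fst z) - f (snd z) \<partial>m)"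
      unfolding \<mu> \<nu> using int by (simp add: integral_distr)
    then have "ennreal (cmod ((\<integral>x. f x \<partial>\<mu>) - (\<integral>x. f x \<partial>\<nu>)))
        \<le> (\<integral>\<^sup>+z. ennreal (cmod (f (fst z) - f (snd z))) \<partial>m)"
      using integral_norm_bound_ennreal[OF Bochner_Integration.integrable_diff[OF int]] by simp
    also have "\<dots> \<le> (\<integral>\<^sup>+z. ennreal L * ennreal (dist (fst z) (snd z)) \<partial>m)"
    proof (rule nn_integral_mono)
      fix z
      have "cmod (f (fst z) - f (snd z)) \<le> L * dist (fst z) (snd z)"
        using lipschitz_onD[OF L, of "fst z" "snd z"] by (simp add: dist_norm)
      then show "ennreal (cmod (f (fst z) - f (snd z))) \<le> ennreal L * ennreal (dist (fst z) (snd z))"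
        using L0 by (simp flip: ennreal_mult add: ennreal_leI)
    qed
    also have "\<dots> = ennreal L * (\<integral>\<^sup>+z. ennreal (dist (fst z) (snd z)) \<partial>m)"
      by (rule nn_integral_cmult) measurable
    also have "\<dots> \<le> ennreal L * ennreal (w + e)"
      using cost by (intro mult_left_mono) auto
    also have "\<dots> = ennreal (L * (w + e))"
      using L0 w e by (simp add: ennreal_mult)
    finally show ?thesis
      using L0 w e by simp
  qed
  have "cmod ((\<integral>x. f x \<partial>\<mu>) - (\<integral>x. f x \<partial>\<nu>)) \<le> L * w + e" if e: "0 < e" for e
  proof -
    \<comment> \<open>Dividing by \<open>L + 1\<close> instead of \<open>L\<close> covers
      \<open>L = 0\<close>.\<close>
    have "L * (e / (L + 1)) \<le> e"
      using L0 e by (simp add: field_simps)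
    then show ?thesis
      using le[of "e / (L + 1)"] L0 e by (simp add: ring_distribs)
  qed
  then show ?thesis
    by (rule field_le_epsilon)
qed

text \<open>The diagonal value 1 bounds the infimum from above. A real lower bound on the curvature
  excludes the value minus infinity, so every distance between the kernels is finite and the
  definition can be solved for it.\<close>

lemma
  assumes "ricci P k = ereal \<kappa>"
  shows ricci_le_1: "\<kappa> \<le> 1"
    and W1_le_of_ricci: "x \<noteq> y \<Longrightarrow> W1 (kernel_pow P k x) (kernel_pow P k y) \<le> ennreal ((1 - \<kappa>) * dist x y)"
proof -
  have le: "ereal \<kappa> \<le> ricci_at P k x y" for x y
    unfolding assms[symmetric] ricci_def by (intro INF_lower2[of x] INF_lower2[of y]) auto
  show "\<kappa> \<le> 1"
    using le[of undefined undefined] by (simp add: ricci_at_def)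
  show "W1 (kernel_pow P k x) (kernel_pow P k y) \<le> ennreal ((1 - \<kappa>) * dist x y)" if xy: "x \<noteq> y"
  proof (cases "W1 (kernel_pow P k x) (kernel_pow P k y)" rule: ennreal_cases)
    case (real w)
    have "ereal \<kappa> \<le> 1 - enn2ereal (ennreal (w / dist x y))"
      using le[of x y] xy real by (simp add: ricci_at_def divide_ennreal)
    then have "ereal \<kappa> \<le> 1 - ereal (w / dist x y)"
      using real by (simp add: enn2ereal_ennreal)
    then have "\<kappa> \<le> 1 - w / dist x y"
      by (simp add: one_ereal_def)
    then have "w \<le> (1 - \<kappa>) * dist x y"
      using xy by (simp add: field_simps)
    then show ?thesis
      unfolding real by (rule ennreal_leI)
  next
    \<comment> \<open>An infinite \<open>W1\<close> divided by the finite distance stays infinite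
      and would make the curvature minus infinity.\<close>
    case top
    then have "ereal \<kappa> \<le> 1 - enn2ereal (\<top> / ennreal (dist x y))"
      using le[of x y] xy by (simp add: ricci_at_def)
    then show ?thesis
      by (simp add: ennreal_top_divide one_ereal_def)
  qed
qed

lemma lipschitz_funpow_kernel_op:
  assumes P: "markov_kernel P" and \<kappa>: "ricci P k = ereal \<kappa>"
    and f: "f \<in> bounded_borel" and L: "L-lipschitz_on UNIV f"
  shows "((1 - \<kappa>) * L)-lipschitz_on UNIV ((kernel_op P ^^ k) f)"
  unfolding funpow_kernel_op[OF P f]
proof (rule lipschitz_onI)
  have L0: "0 \<le> L" using L by (rule lipschitz_on_nonneg)
  have \<kappa>1: "\<kappa> \<le> 1" using \<kappa> by (rule ricci_le_1)
  show "0 \<le> (1 - \<kappa>) * L"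
    using L0 \<kappa>1 by simp
  fix x y
  show "dist (kernel_op (kernel_pow P k) f x) (kernel_op (kernel_pow P k) f y) \<le> (1 - \<kappa>) * L * dist x y"
  proof (cases "x = y")
    case False
    have "cmod (kernel_op (kernel_pow P k) f x - kernel_op (kernel_pow P k) f y) \<le> L * ((1 - \<kappa>) * dist x y)"
      unfolding kernel_op_def using \<kappa>1
      by (intro integral_diff_le_W1[OF f L W1_le_of_ricci[OF \<kappa> False]]) simp
    then show ?thesis
      by (simp add: dist_norm ac_simps)
  qed simp
qed

text \<open>By log-convexity the ratios of consecutive terms increase, so the asymptotic rate bounds the first.\<close>

lemma log_convex_growth:
  fixes a :: "nat \<Rightarrow> real"
  assumes nonneg: "\<And>m. 0 \<le> a m" and convex: "\<And>m. (a (Suc m))\<^sup>2 \<le> a m * a (Suc (Suc m))"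
    and decay: "\<And>n. (a (n * k))\<^sup>2 \<le> C * (c ^ k) ^ (2 * n)" and "1 \<le> k" "0 \<le> c"
  shows "a 1 \<le> c * a 0"
proof (cases "a 0 = 0")
  case True
  then have "(a 1)\<^sup>2 \<le> 0"
    using convex[of 0] by simp
  then show ?thesis
    using True by simp
next
  case False
  then have a0: "0 < a 0"
    using nonneg[of 0] by simp
  define t where "t = a 1 / a 0"
  have t0: "0 \<le> t"
    using nonneg by (simp add: t_def)
  \<comment> \<open>Induction step: \<open>a m * t * a (Suc m)\<close> is at most the square of
    \<open>a (Suc m)\<close>, hence at most \<open>a m * a (Suc (Suc m))\<close>, and
    \<open>a m\<close> cancels. It is nonzero because by convexity a zero term forces the next term
    to be zero.\<close>
  have ratio: "t * a m \<le> a (Suc m)" for m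
  proof (induction m)
    case 0
    show ?case using a0 by (simp add: t_def)
  next
    case (Suc m)
    show ?case
    proof (cases "a (Suc m) = 0")
      case True
      then show ?thesis using nonneg by simp
    next
      case False
      then have pos: "0 < a (Suc m)" using nonneg[of "Suc m"] by simp
      have am: "0 < a m"
      proof (rule ccontr)
        assume "\<not> 0 < a m"
        then have "a m = 0" using nonneg[of m] by simp
        then show False using convex[of m] pos by simp
      qed
      have "a m * (t * a (Suc m)) = (t * a m) * a (Suc m)" by simp
      also have "\<dots> \<le> a (Suc m) * a (Suc m)"
        using Suc pos by (intro mult_right_mono) auto
      also have "\<dots> \<le> a m * a (Suc (Suc m))"
        using convex[of m] by (simp add: power2_eq_square)
      finally show ?thesis
        using am by simp
    qed
  qed
  have growth: "t ^ m * a 0 \<le> a m" for m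
  proof (induction m)
    case (Suc m)
    have "t * (t ^ m * a 0) \<le> t * a m"
      using Suc t0 by (rule mult_left_mono)
    also have "\<dots> \<le> a (Suc m)" by (rule ratio)
    finally show ?case by (simp add: mult.assoc)
  qed simp
  have "t \<le> c"
  proof (rule ccontr)
    assume "\<not> t \<le> c"
    then have tc: "c < t" by simp
    then have tpos: "0 < t" using \<open>0 \<le> c\<close> by simp
    \<comment> \<open>If \<open>t\<close> exceeded \<open>c\<close>, growth at rate \<open>t\<close>
      and decay at rate \<open>c\<close> along multiples of \<open>k\<close> would bound
      \<open>a 0\<close> squared by \<open>C\<close> times powers of \<open>?r < 1\<close>, forcing
      \<open>a 0 = 0\<close>.\<close>
    let ?r = "(c / t) ^ (2 * k)"
    have "?r < 1"
      using tc \<open>1 \<le> k\<close> \<open>0 \<le> c\<close> tpos by (simp add: power_less_one_iff)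
    have bound: "(a 0)\<^sup>2 \<le> C * ?r ^ n" for n
    proof -
      have "(t ^ (n * k) * a 0)\<^sup>2 \<le> C * (c ^ k) ^ (2 * n)"
        using growth[of "n * k"] decay[of n] t0 a0 by (meson order_trans power_mono mult_nonneg_nonneg zero_le_power less_imp_le)
      then have "(a 0)\<^sup>2 * t ^ (2 * k * n) \<le> C * c ^ (2 * k * n)"
        by (simp add: power_mult_distrib ac_simps flip: power_mult)
      then show ?thesis
        using tpos by (simp add: power_divide field_simps flip: power_mult)
    qed
    have "(\<lambda>n. C * ?r ^ n) \<longlonglongrightarrow> C * 0"
      using \<open>?r < 1\<close> \<open>0 \<le> c\<close> tpos by (intro tendsto_intros LIMSEQ_power_zero) auto
    then have "(a 0)\<^sup>2 \<le> C * 0"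
      using bound by (intro LIMSEQ_le_const) auto
    then show False using a0 by simp
  qed
  then show ?thesis
    using a0 by (simp add: t_def field_simps)
qed

text \<open>The Lipschitz hypothesis concerns the \<open>k\<close>-th power, the conclusion a single
  application of \<open>T\<close>. The two are linked by \<open>log_convex_growth\<close> for the
  norms of the iterates of \<open>f\<close>, which all stay in the class where \<open>T\<close> is
  symmetric.\<close>

lemma lipschitz_bs_L2_contraction:
  fixes T :: "('a::polish_space \<Rightarrow> complex) \<Rightarrow> 'a \<Rightarrow> complex"
  assumes "prob_space M" and M: "sets M = sets borel"
    and bb: "\<And>f. f \<in> bounded_borel \<Longrightarrow> T f \<in> bounded_borel"
    and sym: "\<And>f g. f \<in> bounded_borel \<Longrightarrow> g \<in> bounded_borel \<Longrightarrow> L2_inner M (T f) g = L2_inner M f (T g)"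
    and lip: "\<And>f L. f \<in> bounded_borel \<Longrightarrow> L-lipschitz_on UNIV f \<Longrightarrow> (c ^ k * L)-lipschitz_on UNIV ((T ^^ k) f)"
    and "1 \<le> k" "0 \<le> c" and f: "f \<in> lipschitz_bs" "(\<integral>x. f x \<partial>M) = 0"
  shows "L2_norm M (T f) \<le> c * L2_norm M f"
proof -
  interpret prob_space M by fact
  define p where "p m = (T ^^ m) f" for m
  have p: "p m \<in> bounded_borel" for m
    unfolding p_def using bb lipschitz_bs_bounded_borel[OF f(1)] by (induction m) auto
  have pL2: "p m \<in> L2 M" for m
    using bounded_borel_L2[OF prob_space_axioms M p] .
  \<comment> \<open>Symmetry moves powers of \<open>T\<close> one at a time from one argument to the
    other.\<close>
  have shift: "L2_inner M (p (m + i)) (p n) = L2_inner M (p m) (p (n + i))" for m n i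
  proof (induction i arbitrary: n)
    case (Suc i)
    have "L2_inner M (p (m + Suc i)) (p n) = L2_inner M (p (m + i)) (p (Suc n))"
      using sym[OF p p] by (simp add: p_def)
    also have "\<dots> = L2_inner M (p m) (p (n + Suc i))"
      using Suc[of "Suc n"] by simp
    finally show ?case .
  qed simp
  obtain L where L: "L-lipschitz_on UNIV f"
    using f by (auto simp: lipschitz_bs_def)
  have L0: "0 \<le> L" using L by (rule lipschitz_on_nonneg)
  have lip_p: "((c ^ k) ^ n * L)-lipschitz_on UNIV (p (n * k))" for n
  proof (induction n)
    case 0
    show ?case using L by (simp add: p_def)
  next
    case (Suc n)
    have "(T ^^ k) (p (n * k)) = p (Suc n * k)"
      by (simp add: p_def funpow_add)
    with lip[OF p Suc] show ?case by (simp add: ac_simps)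
  qed
  have "bounded {x. f x \<noteq> 0}"
    using f by (simp add: lipschitz_bs_def)
  then obtain r where r: "\<forall>x\<in>{x. f x \<noteq> 0}. dist undefined x \<le> r"
    using bounded_any_center[of _ undefined] by blast
  define C where "C = L2_norm M f * (L * \<bar>r\<bar>)"
  have fL2: "f \<in> L2 M"
    using pL2[of 0] by (simp add: p_def)
  have decay: "cmod (L2_inner M f (p (n * k))) \<le> C * (c ^ k) ^ n" for n
  proof -
    let ?g = "p (n * k)" and ?q = "(c ^ k) ^ n * L * \<bar>r\<bar>"
    \<comment> \<open>As \<open>f\<close> has mean zero, the constant value of \<open>?g\<close> at
      the base point can be subtracted. What remains is at most the Lipschitz constant of
      \<open>?g\<close> times \<open>\<bar>r\<bar>\<close> on the support of
      \<open>f\<close>.\<close>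
    have "L2_inner M f ?g = (\<integral>x. f x * cnj (?g x) \<partial>M) - (\<integral>x. f x * cnj (?g undefined) \<partial>M)"
      unfolding L2_inner_def using f(2) by simp
    also have "\<dots> = (\<integral>x. f x * cnj (?g x) - f x * cnj (?g undefined) \<partial>M)"
      using L2_integrable_mult[OF fL2 pL2] L2_integrable[OF fL2] by simp
    finally have "cmod (L2_inner M f ?g) = cmod (\<integral>x. f x * cnj (?g x) - f x * cnj (?g undefined) \<partial>M)"
      by simp
    also have "\<dots> \<le> (\<integral>x. cmod (f x * cnj (?g x) - f x * cnj (?g undefined)) \<partial>M)"
      by (rule integral_norm_bound)
    also have "\<dots> \<le> (\<integral>x. cmod (f x) * ?q \<partial>M)"
    proof (rule integral_mono)
      show "integrable M (\<lambda>x. cmod (f x * cnj (?g x) - f x * cnj (?g undefined)))"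
        using L2_integrable_mult[OF fL2 pL2] L2_integrable[OF fL2] by auto
      show "integrable M (\<lambda>x. cmod (f x) * ?q)"
        using L2_integrable[OF fL2] by auto
      fix x
      have "cmod (f x * cnj (?g x) - f x * cnj (?g undefined)) = cmod (f x) * cmod (?g x - ?g undefined)"
        by (simp flip: right_diff_distrib complex_cnj_diff add: norm_mult)
      also have "\<dots> \<le> cmod (f x) * ?q"
      proof (cases "f x = 0")
        case False
        then have "dist x undefined \<le> \<bar>r\<bar>"
          using r by (force simp: dist_commute)
        then have "(c ^ k) ^ n * L * dist x undefined \<le> ?q"
          using L0 \<open>0 \<le> c\<close> by (intro mult_left_mono) auto
        then have "cmod (?g x - ?g undefined) \<le> ?q"
          using lipschitz_onD[OF lip_p[of n], of x undefined] by (simp add: dist_norm)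
        then show ?thesis
          by (intro mult_left_mono) auto
      qed simp
      finally show "cmod (f x * cnj (?g x) - f x * cnj (?g undefined)) \<le> cmod (f x) * ?q" .
    qed
    also have "\<dots> = (\<integral>x. cmod (f x) \<partial>M) * ?q"
      by simp
    also have "\<dots> \<le> L2_norm M f * ?q"
      using L0 \<open>0 \<le> c\<close> by (intro mult_right_mono integral_norm_le_L2_norm[OF fL2]) auto
    finally show ?thesis
      by (simp add: C_def ac_simps)
  qed
  have "L2_norm M (p 1) \<le> c * L2_norm M (p 0)"
  proof (rule log_convex_growth[where k = k and C = C and a = "\<lambda>m. L2_norm M (p m)"])
    fix m
    \<comment> \<open>Log-convexity is Cauchy-Schwarz after moving one power of \<open>T\<close>
      across the inner product.\<close>
    have "complex_of_real ((L2_norm M (p (Suc m)))\<^sup>2) = L2_inner M (p m) (p (Suc (Suc m)))"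
      using shift[of m 1 "Suc m"] by (simp add: L2_inner_self)
    then have "(L2_norm M (p (Suc m)))\<^sup>2 = cmod (L2_inner M (p m) (p (Suc (Suc m))))"
      by (metis abs_of_nonneg norm_of_real zero_le_power2)
    then show "(L2_norm M (p (Suc m)))\<^sup>2 \<le> L2_norm M (p m) * L2_norm M (p (Suc (Suc m)))"
      using L2_Cauchy_Schwarz[OF pL2 pL2] by simp
  next
    fix n
    \<comment> \<open>Moving all \<open>n * k\<close> powers to one side doubles the index, which
      accounts for the exponent \<open>2 * n\<close>.\<close>
    have "complex_of_real ((L2_norm M (p (n * k)))\<^sup>2) = L2_inner M f (p (2 * n * k))"
      using shift[of 0 "n * k" "n * k"] by (simp add: L2_inner_self p_def mult_2 ring_distribs)
    then have "(L2_norm M (p (n * k)))\<^sup>2 = cmod (L2_inner M f (p (2 * n * k)))"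
      by (metis abs_of_nonneg norm_of_real zero_le_power2)
    then show "(L2_norm M (p (n * k)))\<^sup>2 \<le> C * (c ^ k) ^ (2 * n)"
      using decay[of "2 * n"] by simp
  qed (use assms in auto)
  then show ?thesis
    by (simp add: p_def)
qed

text \<open>Approximants of a mean-zero function must be recentred without leaving
  \<open>lipschitz_bs\<close>. Constants may have unbounded support, so a multiple of a fixed
  \<open>h0\<close> with nonzero mean is subtracted instead.\<close>

lemma L2_contraction:
  fixes T :: "('a::polish_space \<Rightarrow> complex) \<Rightarrow> 'a \<Rightarrow> complex"
  assumes "prob_space M" and M: "sets M = sets borel" and T: "markov_op M T" and c: "0 \<le> c"
    and lip: "\<And>f. f \<in> lipschitz_bs \<Longrightarrow> (\<integral>x. f x \<partial>M) = 0 \<Longrightarrow> L2_norm M (T f) \<le> c * L2_norm M f"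
    and f: "f \<in> L2 M" "(\<integral>x. f x \<partial>M) = 0"
  shows "L2_norm M (T f) \<le> c * L2_norm M f"
proof (rule field_le_epsilon)
  interpret prob_space M by fact
  have bT: "bounded_op M T" and T_norm: "\<And>f. f \<in> L2 M \<Longrightarrow> L2_norm M (T f) \<le> L2_norm M f"
    using T by (auto simp: markov_op_def)
  note lip_L2 = lipschitz_bs_L2[OF prob_space_axioms M]
  \<comment> \<open>Closeness to the constant 1 within \<open>1 / 2\<close> keeps the mean of
    \<open>h0\<close> away from zero.\<close>
  obtain h0 where h0: "h0 \<in> lipschitz_bs" "L2_norm M (\<lambda>x. 1 - h0 x) < 1 / 2"
    using lipschitz_bs_dense[OF prob_space_axioms M L2_const, of "1 / 2" 1] by auto
  have h0_int: "(\<integral>x. h0 x \<partial>M) \<noteq> 0"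
    using integral_le_L2_norm[OF L2_diff[OF L2_const[of 1] lip_L2[OF h0(1)]]] h0(2) L2_integrable[OF lip_L2[OF h0(1)]]
    by (auto simp: prob_space)
  \<comment> \<open>Since \<open>f\<close> has mean zero, the mean of \<open>h\<close> is at most
    the error of \<open>h\<close>; recentring therefore multiplies that error by at most
    \<open>K\<close>. The further factor \<open>1 + c\<close> in the tolerance pays for the final
    estimate.\<close>
  define K where "K = 1 + L2_norm M h0 / cmod (\<integral>x. h0 x \<partial>M)"
  have K: "0 < K"
    unfolding K_def by (intro add_pos_nonneg) auto
  fix e :: real assume e: "0 < e"
  then have pos: "0 < e / ((1 + c) * K)"
    using K c by simp
  obtain h where h: "h \<in> lipschitz_bs" "L2_norm M (\<lambda>x. f x - h x) < e / ((1 + c) * K)"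
    using lipschitz_bs_dense[OF prob_space_axioms M f(1) pos] by blast
  let ?a = "(\<integral>x. h x \<partial>M) / (\<integral>x. h0 x \<partial>M)"
  let ?h = "\<lambda>x. h x - ?a * h0 x"
  have hl: "?h \<in> lipschitz_bs"
    using h(1) lipschitz_bs_scale[OF h0(1)] by (rule lipschitz_bs_diff)
  have hL2: "h \<in> L2 M" "h0 \<in> L2 M" "?h \<in> L2 M"
    using lip_L2[OF h(1)] lip_L2[OF h0(1)] lip_L2[OF hl] .
  have h_int: "(\<integral>x. ?h x \<partial>M) = 0"
    using hL2 h0_int by (simp add: L2_integrable)
  have "cmod (\<integral>x. h x \<partial>M) \<le> L2_norm M (\<lambda>x. f x - h x)"
    using integral_le_L2_norm[OF L2_diff[OF f(1) hL2(1)]] f hL2 by (simp add: L2_integrable)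
  then have a: "cmod ?a * L2_norm M h0 \<le> L2_norm M (\<lambda>x. f x - h x) * (L2_norm M h0 / cmod (\<integral>x. h0 x \<partial>M))"
    by (simp add: norm_divide divide_right_mono mult_right_mono)
  have "L2_norm M (\<lambda>x. f x - ?h x) = L2_norm M (\<lambda>x. (f x - h x) + ?a * h0 x)"
    by (simp add: algebra_simps)
  also have "\<dots> \<le> L2_norm M (\<lambda>x. f x - h x) + cmod ?a * L2_norm M h0"
    using L2_norm_triangle[OF L2_diff[OF f(1) hL2(1)] L2_scale[OF hL2(2), of ?a]] by (simp only: L2_norm_scale)
  also have "\<dots> \<le> L2_norm M (\<lambda>x. f x - h x) * K"
    using a by (simp add: K_def algebra_simps)
  also have "\<dots> \<le> e / ((1 + c) * K) * K"
    using h K by (intro mult_right_mono) auto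
  also have "\<dots> = e / (1 + c)"
    using K by simp
  finally have d: "L2_norm M (\<lambda>x. f x - ?h x) \<le> e / (1 + c)" .
  let ?d = "\<lambda>x. f x - ?h x"
  have dL2: "?d \<in> L2 M"
    using f(1) hL2(3) by (rule L2_diff)
  \<comment> \<open>The error \<open>?d\<close> is estimated by the norm bound 1 of
    \<open>T\<close>, the approximant \<open>?h\<close> by the contraction \<open>c\<close>.\<close>
  have "L2_norm M (T f) = L2_norm M (\<lambda>x. T ?d x + T ?h x)"
  proof (rule L2_norm_cong_AE)
    show "AE x in M. T f x = T ?d x + T ?h x"
      using bounded_op_diff[OF bT f(1) hL2(3)] by eventually_elim simp
  qed (use bounded_op_L2[OF bT f(1)] bounded_op_L2[OF bT dL2] bounded_op_L2[OF bT hL2(3)] in measurable)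
  also have "\<dots> \<le> L2_norm M ?d + c * L2_norm M ?h"
    using L2_norm_triangle[OF bounded_op_L2[OF bT dL2] bounded_op_L2[OF bT hL2(3)]] T_norm[OF dL2] lip[OF hl h_int]
    by linarith
  also have "L2_norm M ?h \<le> L2_norm M f + L2_norm M ?d"
    using L2_norm_triangle_diff[OF f(1) dL2] by simp
  then have "L2_norm M ?d + c * L2_norm M ?h \<le> L2_norm M ?d + c * (L2_norm M f + L2_norm M ?d)"
    using c by (intro add_left_mono mult_left_mono)
  also have "\<dots> = c * L2_norm M f + (1 + c) * L2_norm M ?d"
    by (simp add: algebra_simps)
  also have "\<dots> \<le> c * L2_norm M f + (1 + c) * (e / (1 + c))"
    using d c by (intro add_left_mono mult_left_mono) auto
  also have "\<dots> = c * L2_norm M f + e"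
    using c by simp
  finally show "L2_norm M (T f) \<le> c * L2_norm M f + e" .
qed

text \<open>If 1 is not simple then \<open>c \<ge> 1\<close>, so the default gap 0 still satisfies
  the bound. An empty spectral set contributes \<open>Sup0 {} = 0 \<le> c\<close>.\<close>

lemma (in prob_space)
  assumes T: "markov_op M T" and c: "0 \<le> c"
    and contr: "\<And>f. f \<in> L2 M \<Longrightarrow> (\<integral>x. f x \<partial>M) = 0 \<Longrightarrow> L2_norm M (T f) \<le> c * L2_norm M f"
  shows abs_spectral_gap_ge: "1 - c \<le> abs_spectral_gap M T"
    and spectral_gap_ge: "1 - c \<le> spectral_gap M T"
proof -
  have bound: "cmod z \<le> c" if "z \<in> spectrum_L2 M T" "z \<noteq> 1" for z
    using T contr c that by (rule spectrum_L2_bound)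
  have simple: "eigenvalue_1_simple M T" if "c < 1"
    using T contr that by (rule eigenvalue_1_simpleI)
  have "Sup0 {cmod z |z. z \<in> spectrum_L2 M T \<and> z \<noteq> 1} \<le> c"
    unfolding Sup0_def using c bound by (auto intro!: cSup_least)
  then show "1 - c \<le> abs_spectral_gap M T"
    using simple by (fastforce simp: abs_spectral_gap_def)
  have "r \<le> c" if "complex_of_real r \<in> spectrum_L2 M T" "r \<noteq> 1" for r
    using bound[OF that(1)] that(2) by simp
  then have "Sup0 {r. complex_of_real r \<in> spectrum_L2 M T \<and> r \<noteq> 1} \<le> c"
    unfolding Sup0_def using c by (auto intro!: cSup_least)
  then show "1 - c \<le> spectral_gap M T"
    using simple by (fastforce simp: spectral_gap_def)
qed

text \<open>A crude bound, used to see that the supremum defining \<open>pseudo_spectral_gap\<close>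
  is over a bounded set: a contraction has its spectrum in the closed unit disc, so the gap is at
  most \<open>1 - (-1)\<close>.\<close>

lemma (in prob_space) spectral_gap_le_2:
  assumes T: "markov_op M T"
  shows "spectral_gap M T \<le> 2"
proof -
  have "\<bar>r\<bar> \<le> 1" if "complex_of_real r \<in> spectrum_L2 M T" "r \<noteq> 1" for r
    using spectrum_L2_bound[OF T _ _ that(1), of 1] that(2) T by (simp add: markov_op_def)
  then have r: "- 1 \<le> r \<and> r \<le> 1" if "r \<in> {r. complex_of_real r \<in> spectrum_L2 M T \<and> r \<noteq> 1}" (is "r \<in> ?S") for r
    using that by fastforce
  have "- 1 \<le> Sup0 ?S"
  proof (cases "?S = {}")
    case False
    then obtain s where s: "s \<in> ?S" by blast
    have "bdd_above ?S"
      using r by (intro bdd_aboveI[of _ 1]) blast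
    from cSup_upper[OF s this] r[OF s] show ?thesis
      using False by (simp add: Sup0_def)
  qed (simp add: Sup0_def)
  then show ?thesis
    by (simp add: spectral_gap_def)
qed

lemma funpow_adjoint:
  assumes A: "\<And>f. f \<in> B \<Longrightarrow> S f \<in> B" "\<And>f. f \<in> B \<Longrightarrow> T f \<in> B"
    and adj: "\<And>f g. f \<in> B \<Longrightarrow> g \<in> B \<Longrightarrow> L2_inner M (S f) g = L2_inner M f (T g)"
    and "f \<in> B" "g \<in> B"
  shows "L2_inner M ((S ^^ k) f) g = L2_inner M f ((T ^^ k) g)"
  using \<open>g \<in> B\<close>
proof (induction k arbitrary: g)
  case (Suc k)
  have "(S ^^ k) f \<in> B"
    using \<open>f \<in> B\<close> A(1) by (induction k) auto
  then have "L2_inner M ((S ^^ Suc k) f) g = L2_inner M f ((T ^^ k) (T g))"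
    using adj[of "(S ^^ k) f" g] Suc.IH[of "T g"] Suc.prems A(2) by simp
  then show ?case
    by (simp only: funpow_Suc_right o_apply)
qed simp

section \<open>Curvature bounds for the absolute and the pseudo spectral gap\<close>

theorem proposition3p5:
  fixes P :: "'a::polish_space \<Rightarrow> 'a measure" and \<pi> :: "'a measure"
  assumes "markov_kernel P"
    and "stationary \<pi> P"
    and "\<forall>x. W1 (return borel x) (P x) < \<infinity>"
  shows "(reversible \<pi> P \<longrightarrow>
            (\<forall>k\<ge>1. \<forall>\<kappa>::real. ricci P k = ereal \<kappa> \<longrightarrow>
               abs_spectral_gap \<pi> (kernel_op P) \<ge> 1 - root k (1 - \<kappa>) \<and>
               1 - root k (1 - \<kappa>) \<ge> \<kappa> / real k)) \<and>
         (\<forall>Pstar. time_reversal \<pi> P Pstar \<longrightarrow>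
            (\<forall>k\<ge>1. \<forall>\<kappa> \<kappa>star::real. ricci P k = ereal \<kappa> \<longrightarrow> ricci Pstar k = ereal \<kappa>star \<longrightarrow>
               pseudo_spectral_gap \<pi> P Pstar \<ge> (1 - (1 - \<kappa>star) * (1 - \<kappa>)) / real k))"
proof (intro conjI impI allI)
  note P = assms(1,2)
  interpret prob_space \<pi> using P(2) by (rule stationary_prob_space)
  note sets = stationary_sets[OF P(2)]
  {
    fix k :: nat and \<kappa> :: real
    assume rev: "reversible \<pi> P" and k: "1 \<le> k" and \<kappa>: "ricci P k = ereal \<kappa>"
    have \<kappa>1: "\<kappa> \<le> 1" using \<kappa> by (rule ricci_le_1)
    let ?c = "root k (1 - \<kappa>)"
    have c: "0 \<le> ?c" "?c ^ k = 1 - \<kappa>"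
      using k \<kappa>1 by (auto simp: real_root_ge_zero)
    note T = markov_op_kernel_op[OF P]
    show "1 - ?c \<le> abs_spectral_gap \<pi> (kernel_op P)"
    proof (rule abs_spectral_gap_ge[OF T c(1)], rule L2_contraction[OF prob_space_axioms sets T c(1)])
      fix f :: "'a \<Rightarrow> complex" assume f: "f \<in> lipschitz_bs" "(\<integral>x. f x \<partial>\<pi>) = 0"
      show "L2_norm \<pi> (kernel_op P f) \<le> ?c * L2_norm \<pi> f"
      proof (rule lipschitz_bs_L2_contraction[OF prob_space_axioms sets _ _ _ k c(1) f])
        show "L2_inner \<pi> (kernel_op P f) g = L2_inner \<pi> f (kernel_op P g)"
          if "f \<in> bounded_borel" "g \<in> bounded_borel" for f g
          using rev that by (intro time_reversal_adjoint[OF P]) (simp add: reversible_def)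
        show "(?c ^ k * L)-lipschitz_on UNIV ((kernel_op P ^^ k) f)"
          if "f \<in> bounded_borel" "L-lipschitz_on UNIV f" for f L
          unfolding c(2) using P(1) \<kappa> that by (rule lipschitz_funpow_kernel_op)
      qed (rule kernel_op_bounded_borel[OF P(1)])
    qed
    \<comment> \<open>Bernoulli's inequality at \<open>?c - 1 \<ge> -1\<close> gives
      \<open>1 - k (1 - ?c) \<le> ?c^k = 1 - \<kappa>\<close>.\<close>
    have "1 + real k * (?c - 1) \<le> (1 + (?c - 1)) ^ k"
      using c by (intro Bernoulli_inequality) simp
    then have "\<kappa> \<le> (1 - ?c) * real k"
      using c by (simp add: algebra_simps)
    then show "\<kappa> / real k \<le> 1 - ?c"
      using k by (simp add: divide_le_eq)
  }
  fix Q k and \<kappa> \<kappa>' :: real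
  assume Q: "time_reversal \<pi> P Q" and k: "1 \<le> k" and \<kappa>: "ricci P k = ereal \<kappa>" "ricci Q k = ereal \<kappa>'"
  have Q': "markov_kernel Q" "stationary \<pi> Q"
    using Q time_reversal_stationary[OF P Q] by (auto simp: time_reversal_def)
  let ?T = "\<lambda>k. (kernel_op Q ^^ k) \<circ> (kernel_op P ^^ k)"
  let ?c = "(1 - \<kappa>') * (1 - \<kappa>)"
  have T: "markov_op \<pi> (?T k)" for k
    by (intro markov_op_comp markov_op_funpow markov_op_kernel_op P Q')
  have c: "0 \<le> ?c"
    using \<kappa>[THEN ricci_le_1] by simp
  note bP = funpow_kernel_op_bounded_borel[OF P(1), of _ k]
    and bQ = funpow_kernel_op_bounded_borel[OF Q'(1), of _ k]
  have adjQ: "L2_inner \<pi> ((kernel_op Q ^^ k) f) g = L2_inner \<pi> f ((kernel_op P ^^ k) g)"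
    if "f \<in> bounded_borel" "g \<in> bounded_borel" for f g
    by (rule funpow_adjoint[OF kernel_op_bounded_borel[OF Q'(1)] kernel_op_bounded_borel[OF P(1)]
          time_reversal_adjoint[OF P Q] that])
  \<comment> \<open>Conjugate symmetry of the inner product exchanges the roles of \<open>P\<close>
    and \<open>Q\<close>.\<close>
  have adjP: "L2_inner \<pi> ((kernel_op P ^^ k) f) g = L2_inner \<pi> f ((kernel_op Q ^^ k) g)"
    if "f \<in> bounded_borel" "g \<in> bounded_borel" for f g
    using adjQ[OF that(2,1)] cnj_L2_inner by metis
  have "1 - ?c \<le> spectral_gap \<pi> (?T k)"
  proof (rule spectral_gap_ge[OF T c(1)], rule L2_contraction[OF prob_space_axioms sets T c(1)])
    fix f :: "'a \<Rightarrow> complex" assume f: "f \<in> lipschitz_bs" "(\<integral>x. f x \<partial>\<pi>) = 0"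
    show "L2_norm \<pi> (?T k f) \<le> ?c * L2_norm \<pi> f"
    \<comment> \<open>Here \<open>order_refl\<close> sets the exponent of the contraction lemma to
      1: the \<open>k\<close> steps of each kernel are already inside \<open>?T k\<close>, and one
      application multiplies Lipschitz constants by both factors of \<open>?c\<close>.\<close>
    proof (rule lipschitz_bs_L2_contraction[OF prob_space_axioms sets _ _ _ order_refl c f])
      show "L2_inner \<pi> (?T k f) g = L2_inner \<pi> f (?T k g)"
        if "f \<in> bounded_borel" "g \<in> bounded_borel" for f g
        using adjQ[OF bP[OF that(1)] that(2)] adjP[OF that(1) bP[OF that(2)]] by simp
      show "(?c ^ 1 * L)-lipschitz_on UNIV ((?T k ^^ 1) f)"
        if "f \<in> bounded_borel" "L-lipschitz_on UNIV f" for f L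
        using lipschitz_funpow_kernel_op[OF Q'(1) \<kappa>(2) bP[OF that(1)]
            lipschitz_funpow_kernel_op[OF P(1) \<kappa>(1) that]]
        by (simp add: mult.assoc)
    qed (simp add: bP bQ)
  qed
  then have "(1 - ?c) / real k \<le> spectral_gap \<pi> (?T k) / real k"
    by (rule divide_right_mono) simp
  \<comment> \<open>The supremum dominates its \<open>k\<close>-th term because the family is
    bounded: each gap is at most 2 and is divided by some \<open>n \<ge> 1\<close>.\<close>
  also have "\<dots> \<le> pseudo_spectral_gap \<pi> P Q"
    unfolding pseudo_spectral_gap_def
  proof (rule cSUP_upper)
    show "bdd_above ((\<lambda>k. spectral_gap \<pi> (?T k) / real k) ` {1..})"
    proof (rule bdd_aboveI2)
      fix n :: nat assume "n \<in> {1..}"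
      then show "spectral_gap \<pi> (?T n) / real n \<le> 2"
        using spectral_gap_le_2[OF T, of n] by (simp add: divide_le_eq)
    qed
  qed (use k in simp)
  finally show "(1 - ?c) / real k \<le> pseudo_spectral_gap \<pi> P Q" .
qed

end
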